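(* Let $0<\lambda\le 1$ be a constant. Let $T_1,\dots,T_m$ be rooted node-labeled trees (the support vectors) and let $\alpha_1,\dots,\alpha_m$ be real weights. After a preprocessing step depending only on $T_1,\dots,T_m$ and $\alpha_1,\dots,\alpha_m$, the prediction value $$f(T)=\sum_{i=1}^{m}\alpha_i K(T_i,T)$$ for any rooted node-labeled tree $T$ given as a query can be computed in $O(|T|^2)$ time in the worst case, where the constant hidden in the $O$-notation does not depend on $m$ or on $T_1,\dots,T_m,\alpha_1,\dots,\alpha_m$.
   Context: Setting: all trees are rooted and their nodes carry labels from a totally ordered alphabet $\Sigma$; $|T|$ denotes the number of nodes of a tree $T$. Suffixes and prefixes: for a node $i$ of a tree $T$, the $i$-th suffix of $T$ is the string of node labels read along the path from node $i$ up to the root of $T$ (both endpoints included). A prefix of a string is a (nonempty) substring beginning with its first character. Subpath kernel: for trees $T',T''$, $$K(T',T'')=\sum_{s\in S}\lambda^{|s|}\,\mathrm{num}(T'_{s})\,\mathrm{num}(T''_{s}),$$ where $S$ is the set of all distinct strings that occur as a prefix of a suffix of $T'$ or of $T''$, $|s|$ is the length of $s$, and $\mathrm{num}(T'_s)$ is the number of nodes $i$ of $T'$ such that $s$ is a prefix of the $i$-th suffix of $T'$ (similarly for $T''$). Preprocessing and query: the preprocessing step builds a data structure from the support vectors and the weights (in the paper, an enhanced suffix array of the "master tree" obtained by concatenating all support vector trees); its cost is not counted in the prediction time. The prediction time is the time needed, given this stored data structure and a query tree $T$, to output $f(T)$. Computational model: unit-cost word RAM in which every label fits in one machine word, and arithmetic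 operations on the numbers involved in evaluating $f(T)$ (integers and real numbers) have unit cost. *)

theory Defs
  imports Complex_Main "HOL-Library.Sublist"
begin

section \<open>Rooted node-labeled trees and the subpath kernel\<close>

text \<open>A tree with \<open>n\<close> nodes is a list of length \<open>n\<close>; its nodes are the indices \<open>i < n\<close>, and entry \<open>i\<close>
  holds the label of node \<open>i\<close> and its parent (\<^const>\<open>None\<close> for the root). The numbering of the
  nodes is arbitrary.\<close>

type_synonym 'a ltree = "('a \<times> nat option) list"

definition label :: "'a ltree \<Rightarrow> nat \<Rightarrow> 'a" where
  "label T i = fst (T ! i)"

definition parent :: "'a ltree \<Rightarrow> nat \<Rightarrow> nat option" where
  "parent T i = snd (T ! i)"

definition parent_rel :: "'a ltree \<Rightarrow> (nat \<times> nat) set" where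
  "parent_rel T = {(i, p). i < length T \<and> p < length T \<and> parent T i = Some p}"

text \<open>Since \<open>r\<close> has no parent, reachability of \<open>r\<close> from every node already excludes cycles, further
  roots, and parents that are not nodes.\<close>

definition rooted_tree :: "'a set \<Rightarrow> 'a ltree \<Rightarrow> bool" where
  "rooted_tree \<Sigma> T \<longleftrightarrow>
     (\<forall>i < length T. label T i \<in> \<Sigma>) \<and>
     (\<exists>r < length T. parent T r = None \<and> (\<forall>i < length T. (i, r) \<in> (parent_rel T)\<^sup>*))"

inductive up_string :: "'a ltree \<Rightarrow> nat \<Rightarrow> 'a list \<Rightarrow> bool" for T where
  root: "parent T i = None \<Longrightarrow> up_string T i [label T i]"
| step: "parent T i = Some p \<Longrightarrow> up_string T p s \<Longrightarrow> up_string T i (label T i # s)"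

definition node_suffix :: "'a ltree \<Rightarrow> nat \<Rightarrow> 'a list" where
  "node_suffix T i = (THE s. up_string T i s)"

lemma up_string_unique: "up_string T i s \<Longrightarrow> up_string T i s' \<Longrightarrow> s = s'"
proof (induction arbitrary: s' rule: up_string.induct)
  case (root i)
  from root(2,1) show ?case by cases auto
next
  case (step i p s)
  from step(4) show ?case using step(1,3) by cases auto
qed

lemma up_string_node_suffix:
  assumes "rooted_tree \<Sigma> T" "i < length T"
  shows "up_string T i (node_suffix T i)"
proof -
  obtain r where r: "parent T r = None" "(i, r) \<in> (parent_rel T)\<^sup>*"
    using assms unfolding rooted_tree_def by blast
  from r(2) have "\<exists>s. up_string T i s"
  proof (induction rule: converse_rtrancl_induct)
    case base
    show ?case using up_string.root[OF r(1)] by blast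
  next
    case (step i p)
    then show ?case unfolding parent_rel_def by (blast intro: up_string.step)
  qed
  then show ?thesis
    unfolding node_suffix_def by (metis theI up_string_unique)
qed

lemma node_suffix_simp:
  assumes "rooted_tree \<Sigma> T" "i < length T"
  shows "node_suffix T i =
    label T i # (case parent T i of None \<Rightarrow> [] | Some p \<Rightarrow> node_suffix T p)"
  using up_string_node_suffix[OF assms]
proof cases
  case root
  then show ?thesis by simp
next
  case (step p s)
  then have "node_suffix T p = s"
    unfolding node_suffix_def by (blast intro: up_string_unique)
  with step show ?thesis by simp
qed

definition num :: "'a ltree \<Rightarrow> 'a list \<Rightarrow> nat" where
  "num T s = card {i. i < length T \<and> prefix s (node_suffix T i)}"

definition subpaths :: "'a ltree \<Rightarrow> 'a list set" where
  "subpaths T = {s. s \<noteq> [] \<and> (\<exists>i < length T. prefix s (node_suffix T i))}"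

definition subpath_kernel :: "real \<Rightarrow> 'a ltree \<Rightarrow> 'a ltree \<Rightarrow> real" where
  "subpath_kernel lam T' T'' =
     (\<Sum>s \<in> subpaths T' \<union> subpaths T''. lam ^ length s * real (num T' s) * real (num T'' s))"

definition prediction :: "real \<Rightarrow> 'a ltree list \<Rightarrow> real list \<Rightarrow> 'a ltree \<Rightarrow> real" where
  "prediction lam Ts \<alpha>s T = (\<Sum>i < length Ts. \<alpha>s ! i * subpath_kernel lam (Ts ! i) T)"


section \<open>Word RAM with unit-cost real arithmetic\<close>

text \<open>A word RAM with word length \<open>w\<close>: word registers, word memory and the input array hold numbers
  below \<open>2 ^ w\<close>, word arithmetic is modulo \<open>2 ^ w\<close>, and memory addresses are words. Real numbers live
  in registers and memory cells of their own; they support the field operations, comparison and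
  conversion from words, but no conversion back to words (no rounding), so they cannot be used to
  circumvent the word length. The input arrays are read-only and randomly accessible. Register
  names are part of the instructions, so a program uses only finitely many registers. Division by
  zero yields zero.\<close>

datatype wop = WAdd | WSub | WMul | WDiv | WMod

datatype rop = RAdd | RSub | RMul | RDiv

datatype instr =
    WConst nat nat            \<comment> \<open>target, constant\<close>
  | WOp wop nat nat nat       \<comment> \<open>target, operands\<close>
  | WLoad nat nat             \<comment> \<open>target, address\<close>
  | WStore nat nat            \<comment> \<open>address, source\<close>
  | WInput nat nat            \<comment> \<open>target, input position\<close>
  | ROfWord nat nat           \<comment> \<open>real target, word source\<close>
  | ROp rop nat nat nat
  | RLoad nat nat             \<comment> \<open>real target, address\<close>
  | RStore nat nat            \<comment> \<open>address, real source\<close>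
  | RInput nat nat            \<comment> \<open>real target, input position\<close>
  | Jump nat
  | JumpLess nat nat nat      \<comment> \<open>word operands, jump target\<close>
  | JumpEq nat nat nat
  | JumpRLess nat nat nat     \<comment> \<open>real operands, jump target\<close>

record store =
  wreg :: "nat \<Rightarrow> nat"
  wmem :: "nat \<Rightarrow> nat"
  rreg :: "nat \<Rightarrow> real"
  rmem :: "nat \<Rightarrow> real"

definition empty_store :: store where
  "empty_store = \<lparr>wreg = (\<lambda>_. 0), wmem = (\<lambda>_. 0), rreg = (\<lambda>_. 0), rmem = (\<lambda>_. 0)\<rparr>"

fun eval_wop :: "nat \<Rightarrow> wop \<Rightarrow> nat \<Rightarrow> nat \<Rightarrow> nat" where
  "eval_wop w WAdd x y = (x + y) mod 2 ^ w"
| "eval_wop w WSub x y = nat ((int x - int y) mod 2 ^ w)"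
| "eval_wop w WMul x y = (x * y) mod 2 ^ w"
| "eval_wop w WDiv x y = (x div y) mod 2 ^ w"
| "eval_wop w WMod x y = (x mod y) mod 2 ^ w"

fun eval_rop :: "rop \<Rightarrow> real \<Rightarrow> real \<Rightarrow> real" where
  "eval_rop RAdd x y = x + y"
| "eval_rop RSub x y = x - y"
| "eval_rop RMul x y = x * y"
| "eval_rop RDiv x y = x / y"

definition read_input :: "'b::zero list \<Rightarrow> nat \<Rightarrow> 'b" where
  "read_input xs i = (if i < length xs then xs ! i else 0)"

fun exec_instr :: "nat \<Rightarrow> nat list \<Rightarrow> real list \<Rightarrow> instr \<Rightarrow> nat \<times> store \<Rightarrow> nat \<times> store" where
  "exec_instr w inp rinp (WConst d k) (pc, s) =
     (Suc pc, s\<lparr>wreg := (wreg s)(d := k mod 2 ^ w)\<rparr>)"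
| "exec_instr w inp rinp (WOp f d a b) (pc, s) =
     (Suc pc, s\<lparr>wreg := (wreg s)(d := eval_wop w f (wreg s a) (wreg s b))\<rparr>)"
| "exec_instr w inp rinp (WLoad d a) (pc, s) =
     (Suc pc, s\<lparr>wreg := (wreg s)(d := wmem s (wreg s a))\<rparr>)"
| "exec_instr w inp rinp (WStore a b) (pc, s) =
     (Suc pc, s\<lparr>wmem := (wmem s)(wreg s a := wreg s b)\<rparr>)"
| "exec_instr w inp rinp (WInput d a) (pc, s) =
     (Suc pc, s\<lparr>wreg := (wreg s)(d := read_input inp (wreg s a) mod 2 ^ w)\<rparr>)"
| "exec_instr w inp rinp (ROfWord d a) (pc, s) =
     (Suc pc, s\<lparr>rreg := (rreg s)(d := real (wreg s a))\<rparr>)"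
| "exec_instr w inp rinp (ROp f d a b) (pc, s) =
     (Suc pc, s\<lparr>rreg := (rreg s)(d := eval_rop f (rreg s a) (rreg s b))\<rparr>)"
| "exec_instr w inp rinp (RLoad d a) (pc, s) =
     (Suc pc, s\<lparr>rreg := (rreg s)(d := rmem s (wreg s a))\<rparr>)"
| "exec_instr w inp rinp (RStore a b) (pc, s) =
     (Suc pc, s\<lparr>rmem := (rmem s)(wreg s a := rreg s b)\<rparr>)"
| "exec_instr w inp rinp (RInput d a) (pc, s) =
     (Suc pc, s\<lparr>rreg := (rreg s)(d := read_input rinp (wreg s a))\<rparr>)"
| "exec_instr w inp rinp (Jump l) (pc, s) = (l, s)"
| "exec_instr w inp rinp (JumpLess a b l) (pc, s) =
     (if wreg s a < wreg s b then l else Suc pc, s)"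
| "exec_instr w inp rinp (JumpEq a b l) (pc, s) =
     (if wreg s a = wreg s b then l else Suc pc, s)"
| "exec_instr w inp rinp (JumpRLess a b l) (pc, s) =
     (if rreg s a < rreg s b then l else Suc pc, s)"

definition ram_step ::
  "nat \<Rightarrow> instr list \<Rightarrow> nat list \<Rightarrow> real list \<Rightarrow> nat \<times> store \<Rightarrow> nat \<times> store" where
  "ram_step w prog inp rinp cfg =
     (if fst cfg < length prog then exec_instr w inp rinp (prog ! fst cfg) cfg else cfg)"

text \<open>The program, started at its first instruction in store \<open>s\<close>, has left the program text after at
  most \<open>t\<close> instructions, with final store \<open>s'\<close>.\<close>

definition halts_within ::
  "nat \<Rightarrow> instr list \<Rightarrow> nat list \<Rightarrow> real list \<Rightarrow> store \<Rightarrow> nat \<Rightarrow> store \<Rightarrow> bool" where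
  "halts_within w prog inp rinp s t s' \<longleftrightarrow>
     (\<exists>pc \<ge> length prog. (ram_step w prog inp rinp ^^ t) (0, s) = (pc, s'))"


section \<open>Input encoding\<close>

text \<open>\<open>code\<close> gives the machine word that represents a label. A tree is passed as its number of nodes,
  the array of labels and the array of parents, with parent \<open>p\<close> written as \<open>p + 1\<close> and \<open>0\<close> marking
  the root.\<close>

definition encode_tree :: "('a \<Rightarrow> nat) \<Rightarrow> 'a ltree \<Rightarrow> nat list" where
  "encode_tree code T =
     length T # map (\<lambda>(a, _). code a) T @ map (\<lambda>(_, p). case p of None \<Rightarrow> 0 | Some q \<Rightarrow> Suc q) T"

definition encode_forest :: "('a \<Rightarrow> nat) \<Rightarrow> 'a ltree list \<Rightarrow> nat list" where
  "encode_forest code Ts = length Ts # concat (map (encode_tree code) Ts)"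

text \<open>The usual word RAM convention that a word has at least \<open>c \<sqdot> log n\<close> bits for the total input size
  \<open>n\<close>, where \<open>c\<close> is a constant; the offset \<open>2\<close> only keeps the base away from \<open>0\<close> and \<open>1\<close>.\<close>

definition addressable :: "nat \<Rightarrow> nat \<Rightarrow> 'a ltree list \<Rightarrow> bool" where
  "addressable c w Ts \<longleftrightarrow> (sum_list (map length Ts) + 2) ^ c \<le> 2 ^ w"

end

theory Submission
  imports Defs
begin

text \<open>Rewrite \<open>f(T)\<close> as \<open>\<Sum>i. \<Sum>s. W s\<close>, where \<open>i\<close> runs over the nodes of \<open>T\<close>, \<open>s\<close> over the nonempty
  prefixes of the \<open>i\<close>-th suffix, and \<open>W s = \<lambda>\<^sup>|\<^sup>s\<^sup>| \<Sum>j. \<alpha>\<^sub>j num (T\<^sub>j) s\<close> does not depend on \<open>T\<close>. It therefore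
  suffices to store \<open>W\<close> at the nodes of a trie of all suffixes of the support vectors: a query walks
  from each of its nodes up to the root, follows the trie in parallel and adds up the weights, which
  takes \<open>|T|\<close> steps per node. A trie step has to take constant time whatever the alphabet and the
  size of the support vectors. The word memory has a cell for every label, so labels are first mapped
  to small ranks by direct addressing; transitions are then found in a table indexed by state and
  rank.\<close>

section \<open>Structured programs\<close>

text \<open>Label codes may be arbitrary words, so a rank table indexed by codes can spread over the
  whole word memory and leaves no region free for the transition table. The two tables therefore
  share cells, as the two digits of a cell in a base \<open>K\<close>. Ranks and states lie below
  \<open>K\<close>, so table positions and cell contents lie below \<open>K * K\<close>, and this
  product has to fit into a word. With \<open>N\<close> nodes in all support vectors, inserting
  every suffix uses at most \<open>1 + 2 * N * N\<close> numbers, which is below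
  \<open>K = (2 + 2 * N)^2\<close>; then \<open>K * K\<close> is at most \<open>(N + 2)^8\<close>,
  whence the word-length constant 8. Sharing does no harm: a label without rank has low digit 0 even
  if its cell holds a transition, and row 0 and column 0 of the transition table stay empty. An
  unknown label thus leads to the dead state 0, whose weight is 0.\<close>

datatype com =
    Block "instr list"
  | Seq com com  (infixr ";;" 60)
  | IfEq nat nat com
  | WhileNe nat nat com

text \<open>Jump targets of the machine are absolute, hence the load address \<open>l\<close>. Only
  jumps on equality are used: \<open>IfEq\<close> reaches its body by jumping over a jump that skips
  it, and \<open>WhileNe\<close> jumps out once the registers agree.\<close>

fun compile :: "nat \<Rightarrow> com \<Rightarrow> instr list" where
  "compile l (Block is) = is"
| "compile l (c ;; d) = compile l c @ compile (l + length (compile l c)) d"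
| "compile l (IfEq a b c) =
     JumpEq a b (l + 2) # Jump (l + 2 + length (compile (l + 2) c)) # compile (l + 2) c"
| "compile l (WhileNe a b c) =
     JumpEq a b (l + 2 + length (compile (Suc l) c)) # compile (Suc l) c @ [Jump l]"

fun is_jump :: "instr \<Rightarrow> bool" where
  "is_jump (Jump _) = True"
| "is_jump (JumpLess _ _ _) = True"
| "is_jump (JumpEq _ _ _) = True"
| "is_jump (JumpRLess _ _ _) = True"
| "is_jump _ = False"

lemma exec_instr_no_jump:
  "\<not> is_jump i \<Longrightarrow>
     exec_instr w inp rinp i (pc, s) = (Suc pc, snd (exec_instr w inp rinp i (0, s)))"
  by (cases i) auto

section \<open>Instruction-counting semantics and compiler correctness\<close>

context
  fixes w :: nat and inp :: "nat list" and rinp :: "real list"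
begin

text \<open>The clock is the exact number of machine instructions: a skipped \<open>IfEq\<close>
  costs its test and a jump, and each round of \<open>WhileNe\<close> costs a test and a jump back
  besides its body.\<close>

inductive exec :: "com \<Rightarrow> store \<Rightarrow> nat \<Rightarrow> store \<Rightarrow> bool" where
  Nil: "exec (Block []) s 0 s"
| Cons: "\<not> is_jump i \<Longrightarrow> exec (Block is) (snd (exec_instr w inp rinp i (0, s))) t s'
    \<Longrightarrow> exec (Block (i # is)) s (Suc t) s'"
| Seq: "exec c s t s' \<Longrightarrow> exec d s' t' s'' \<Longrightarrow> exec (c ;; d) s (t + t') s''"
| IfTrue: "wreg s a = wreg s b \<Longrightarrow> exec c s t s' \<Longrightarrow> exec (IfEq a b c) s (Suc t) s'"
| IfFalse: "wreg s a \<noteq> wreg s b \<Longrightarrow> exec (IfEq a b c) s 2 s"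
| WhileDone: "wreg s a = wreg s b \<Longrightarrow> exec (WhileNe a b c) s 1 s"
| WhileStep: "wreg s a \<noteq> wreg s b \<Longrightarrow> exec c s t s' \<Longrightarrow> exec (WhileNe a b c) s' t' s''
    \<Longrightarrow> exec (WhileNe a b c) s (Suc (t + Suc t')) s''"

text \<open>Fragments run inside a larger program, hence the arbitrary \<open>pre\<close> and
  \<open>post\<close>. Induction is on the run rather than on the command, since the remaining
  rounds of a loop are a run of the same command at the same address.\<close>

lemma exec_compile:
  assumes "exec c s t s'"
    and "prog = pre @ compile (length pre) c @ post"
  shows "(ram_step w prog inp rinp ^^ t) (length pre, s)
       = (length pre + length (compile (length pre) c), s')"
  using assms
proof (induction arbitrary: pre post rule: exec.induct)
  case (Nil s)
  then show ?case by simp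
next
  case (Cons i "is" s t s')
  have "ram_step w prog inp rinp (length pre, s)
      = (length (pre @ [i]), snd (exec_instr w inp rinp i (0, s)))"
    using Cons.prems exec_instr_no_jump[OF Cons.hyps(1), of w inp rinp "length pre" s]
    by (simp add: ram_step_def nth_append)
  moreover have "(ram_step w prog inp rinp ^^ t)
        (length (pre @ [i]), snd (exec_instr w inp rinp i (0, s)))
      = (length (pre @ [i]) + length is, s')"
    using Cons.IH[of "pre @ [i]" post] Cons.prems by simp
  ultimately show ?case by (simp add: funpow_swap1)
next
  case (Seq c s t s' d t' s'')
  let ?c = "compile (length pre) c"
  have "(ram_step w prog inp rinp ^^ t) (length pre, s) = (length (pre @ ?c), s')"
    using Seq.IH(1)[of pre "compile (length pre + length ?c) d @ post"] Seq.prems by simp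
  moreover have "(ram_step w prog inp rinp ^^ t') (length (pre @ ?c), s')
      = (length (pre @ ?c) + length (compile (length (pre @ ?c)) d), s'')"
    using Seq.IH(2)[of "pre @ ?c" post] Seq.prems by simp
  ultimately show ?case by (simp add: funpow_add add.commute[of t t'])
next
  case (IfTrue s a b c t s')
  let ?p = "pre @ take 2 (compile (length pre) (IfEq a b c))"
  have "ram_step w prog inp rinp (length pre, s) = (length ?p, s)"
    using IfTrue.prems IfTrue.hyps(1) by (simp add: ram_step_def nth_append)
  moreover have "(ram_step w prog inp rinp ^^ t) (length ?p, s)
      = (length ?p + length (compile (length ?p) c), s')"
    using IfTrue.IH[of ?p post] IfTrue.prems by simp
  ultimately show ?case by (simp add: funpow_swap1)
next
  case (IfFalse s a b c)
  then show ?case by (simp add: ram_step_def nth_append numeral_2_eq_2)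
next
  case (WhileDone s a b c)
  then show ?case by (simp add: ram_step_def nth_append)
next
  case (WhileStep s a b c t s' t' s'')
  let ?p = "pre @ [JumpEq a b (length pre + 2 + length (compile (Suc (length pre)) c))]"
  have 1: "ram_step w prog inp rinp (length pre, s) = (length ?p, s)"
    using WhileStep.prems WhileStep.hyps(1) by (simp add: ram_step_def nth_append)
  have 2: "(ram_step w prog inp rinp ^^ t) (length ?p, s)
      = (length ?p + length (compile (length ?p) c), s')"
    using WhileStep.IH(1)[of ?p "Jump (length pre) # post"] WhileStep.prems by simp
  have 3: "ram_step w prog inp rinp (length ?p + length (compile (length ?p) c), s')
      = (length pre, s')"
    using WhileStep.prems by (simp add: ram_step_def nth_append)
  have 4: "(ram_step w prog inp rinp ^^ t') (length pre, s')
      = (length pre + length (compile (length pre) (WhileNe a b c)), s'')"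
    using WhileStep.IH(2) WhileStep.prems by blast
  have "(ram_step w prog inp rinp ^^ Suc t) (length pre, s)
      = (length ?p + length (compile (length ?p) c), s')"
    using 1 2 by (simp add: funpow_swap1 del: length_append)
  then have "(ram_step w prog inp rinp ^^ Suc (Suc t)) (length pre, s) = (length pre, s')"
    using 3 by (simp only: funpow.simps comp_apply)
  then have "(ram_step w prog inp rinp ^^ (t' + Suc (Suc t))) (length pre, s)
      = (length pre + length (compile (length pre) (WhileNe a b c)), s'')"
    using 4 by (simp only: funpow_add comp_apply)
  moreover have "t' + Suc (Suc t) = Suc (t + Suc t')" by simp
  ultimately show ?case by (simp only:)
qed

lemma ram_step_halted:
  "length prog \<le> pc \<Longrightarrow> (ram_step w prog inp rinp ^^ t) (pc, s) = (pc, s)"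
  by (induction t) (auto simp: ram_step_def)

lemma exec_halts_within:
  assumes "exec c s t s'" "t \<le> t'"
  shows "halts_within w (compile 0 c) inp rinp s t' s'"
proof -
  have "(ram_step w (compile 0 c) inp rinp ^^ t) (0, s) = (length (compile 0 c), s')"
    using exec_compile[OF assms(1), of "compile 0 c" "[]" "[]"] by simp
  then have "(ram_step w (compile 0 c) inp rinp ^^ (t' - t + t)) (0, s)
      = (length (compile 0 c), s')"
    by (simp only: funpow_add comp_apply ram_step_halted[OF order_refl])
  then show ?thesis
    using assms(2) unfolding halts_within_def by auto
qed

text \<open>The predicate transformer threads a clock through the program, so that one calculus serves
  both correctness and running time.\<close>

definition wp :: "com \<Rightarrow> (nat \<Rightarrow> store \<Rightarrow> bool) \<Rightarrow> nat \<Rightarrow> store \<Rightarrow> bool" where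
  "wp c Q k s \<longleftrightarrow> (\<exists>t s'. exec c s t s' \<and> Q (k + t) s')"

inductive_cases NilE: "exec (Block []) s t s'"
inductive_cases ConsE: "exec (Block (i # is)) s t s'"
inductive_cases SeqE: "exec (c ;; d) s t s'"
inductive_cases IfEqE: "exec (IfEq a b c) s t s'"
inductive_cases WhileNeE: "exec (WhileNe a b c) s t s'"

text \<open>As equivalences, these rules let the simplifier execute straight-line code symbolically,
  clock included. The one for \<open>WhileNe\<close> stays out of the simpset because it applies to
  its own result.\<close>

lemma wp_Nil [simp]: "wp (Block []) Q k s \<longleftrightarrow> Q k s"
  unfolding wp_def by (force elim: NilE intro: exec.Nil)

lemma wp_Cons [simp]:
  "wp (Block (i # is)) Q k s \<longleftrightarrow>
     \<not> is_jump i \<and> wp (Block is) Q (Suc k) (snd (exec_instr w inp rinp i (0, s)))"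
  unfolding wp_def by (force elim: ConsE intro: exec.Cons)

lemma wp_Seq [simp]: "wp (c ;; d) Q k s \<longleftrightarrow> wp c (wp d Q) k s"
  unfolding wp_def by (force elim: SeqE intro: exec.Seq simp: add.assoc)

lemma wp_IfEq [simp]:
  "wp (IfEq a b c) Q k s \<longleftrightarrow>
     (if wreg s a = wreg s b then wp c Q (Suc k) s else Q (k + 2) s)"
  unfolding wp_def by (force elim: IfEqE intro: exec.IfTrue exec.IfFalse)

lemma wp_WhileNe:
  "wp (WhileNe a b c) Q k s \<longleftrightarrow>
     (if wreg s a = wreg s b then Q (Suc k) s
      else wp c (\<lambda>k'. wp (WhileNe a b c) Q (Suc k')) (Suc k) s)"
  unfolding wp_def
  by (force elim: WhileNeE intro: exec.WhileDone exec.WhileStep[simplified] simp: add.assoc)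

lemma wp_mono: "wp c Q k s \<Longrightarrow> (\<And>k s. Q k s \<Longrightarrow> R k s) \<Longrightarrow> wp c R k s"
  unfolding wp_def by blast

text \<open>Round number and clock are arguments of the invariant, so termination needs no separate
  measure. \<open>Suc k\<close> accounts for the test and \<open>Suc k'\<close> for the jump
  back.\<close>

lemma wp_for:
  assumes step: "\<And>i k s. i < n \<Longrightarrow> I i k s \<Longrightarrow>
      wreg s a \<noteq> wreg s b \<and> wp c (\<lambda>k'. I (Suc i) (Suc k')) (Suc k) s"
    and exit: "\<And>k s. I n k s \<Longrightarrow> wreg s a = wreg s b \<and> Q (Suc k) s"
    and init: "I 0 k s"
  shows "wp (WhileNe a b c) Q k s"
proof -
  have "wp (WhileNe a b c) Q k s" if "i \<le> n" "I i k s" for i k s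
    using that
  proof (induction "n - i" arbitrary: i k s)
    case 0
    then show ?case using exit by (simp add: wp_WhileNe)
  next
    case (Suc d)
    then have "i < n" by simp
    have "wp c (\<lambda>k'. wp (WhileNe a b c) Q (Suc k')) (Suc k) s"
      by (rule wp_mono, rule conjunct2[OF step[OF \<open>i < n\<close> Suc.prems(2)]])
        (use Suc.hyps(1)[of "Suc i"] Suc.hyps(2) \<open>i < n\<close> in auto)
    then show ?case
      using step[OF \<open>i < n\<close> Suc.prems(2)] by (simp add: wp_WhileNe[of a b c Q k s])
  qed
  then show ?thesis using init by blast
qed

end

section \<open>A trie in direct-address memory\<close>

text \<open>Every memory cell \<open>x\<close> serves two purposes: \<open>mem x mod K\<close> is the rank of the label \<open>x\<close> (\<open>0\<close> if the
  label does not occur), and \<open>mem x div K\<close> is the transition stored at the table position \<open>x\<close>. The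
  root is state \<open>1\<close>; state \<open>0\<close> stands for all strings outside the trie and is absorbing, so a query
  needs no case distinction. Ranks and states are drawn from the same counter \<open>cnt\<close>.\<close>

definition trie ::
  "nat \<Rightarrow> nat \<Rightarrow> (nat list \<Rightarrow> nat) \<Rightarrow> (nat \<Rightarrow> nat) \<Rightarrow> (nat \<Rightarrow> real) \<Rightarrow> (nat list \<Rightarrow> real) \<Rightarrow> bool"
  where
  "trie K cnt st mem rm W \<longleftrightarrow>
     0 < cnt \<and> cnt < K \<and> st [] = 1 \<and>
     (\<forall>s. st s \<le> cnt) \<and> (\<forall>a. mem a mod K \<le> cnt) \<and>
     (\<forall>s s'. st s = st s' \<longrightarrow> st s \<noteq> 0 \<longrightarrow> s = s') \<and>
     (\<forall>a b. mem a mod K = mem b mod K \<longrightarrow> mem a mod K \<noteq> 0 \<longrightarrow> a = b) \<and>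
     (\<forall>s a. mem (st s * K + mem a mod K) div K = st (s @ [a])) \<and>
     (\<forall>x. mem x div K \<noteq> 0 \<longrightarrow>
        (\<exists>s a. x = st s * K + mem a mod K \<and> st s \<noteq> 0 \<and> mem a mod K \<noteq> 0)) \<and>
     (\<forall>x > cnt. rm x = 0) \<and> rm 0 = 0 \<and> (\<forall>s. rm (st s) = W s)"

lemma trieD:
  assumes "trie K cnt st mem rm W"
  shows "0 < cnt" "cnt < K" "st [] = 1" "st s \<le> cnt" "mem a mod K \<le> cnt"
    "st s = st s' \<Longrightarrow> st s \<noteq> 0 \<Longrightarrow> s = s'"
    "mem a mod K = mem b mod K \<Longrightarrow> mem a mod K \<noteq> 0 \<Longrightarrow> a = b"
    "mem (st s * K + mem a mod K) div K = st (s @ [a])"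
    "mem x div K \<noteq> 0 \<Longrightarrow>
       \<exists>s a. x = st s * K + mem a mod K \<and> st s \<noteq> 0 \<and> mem a mod K \<noteq> 0"
    "x > cnt \<Longrightarrow> rm x = 0" "rm 0 = 0" "rm (st s) = W s"
  using assms unfolding trie_def by blast+

lemma trieI:
  assumes "0 < cnt" "cnt < K" "st [] = 1" "\<And>s. st s \<le> cnt" "\<And>a. mem a mod K \<le> cnt"
    "\<And>s s'. st s = st s' \<Longrightarrow> st s \<noteq> 0 \<Longrightarrow> s = s'"
    "\<And>a b. mem a mod K = mem b mod K \<Longrightarrow> mem a mod K \<noteq> 0 \<Longrightarrow> a = b"
    "\<And>s a. mem (st s * K + mem a mod K) div K = st (s @ [a])"
    "\<And>x. mem x div K \<noteq> 0 \<Longrightarrow>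
       \<exists>s a. x = st s * K + mem a mod K \<and> st s \<noteq> 0 \<and> mem a mod K \<noteq> 0"
    "\<And>x. x > cnt \<Longrightarrow> rm x = 0" "rm 0 = 0" "\<And>s. rm (st s) = W s"
  shows "trie K cnt st mem rm W"
  unfolding trie_def using assms by blast

section \<open>Packed cells: digits, empty transitions and size bounds\<close>

lemma digits_unique:
  fixes K :: nat
  assumes "q * K + r = q' * K + r'" "r < K" "r' < K"
  shows "q = q' \<and> r = r'"
proof -
  have "(q * K + r) div K = (q' * K + r') div K" "(q * K + r) mod K = (q' * K + r') mod K"
    using assms(1) by simp_all
  then show ?thesis using assms(2,3) by simp
qed

lemma trie_init:
  assumes "1 < K"
  shows "trie K 1 (\<lambda>s. if s = [] then 1 else 0) (\<lambda>_. 0) (\<lambda>_. 0) (\<lambda>_. 0)"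
  using assms unfolding trie_def by (auto split: if_splits)

text \<open>A nonzero transition sits only at a position formed from a nonzero state and a nonzero
  rank, and the position determines both. Hence row 0, column 0 and the rows and columns of numbers
  not yet issued are empty.\<close>

lemma trie_no_edge:
  assumes t: "trie K cnt st mem rm W" and r: "r < K"
    and no: "q = 0 \<or> r = 0 \<or> q > cnt \<or> r > cnt"
  shows "mem (q * K + r) div K = 0"
proof (rule ccontr)
  assume "mem (q * K + r) div K \<noteq> 0"
  then obtain s a where sa: "q * K + r = st s * K + mem a mod K" "st s \<noteq> 0" "mem a mod K \<noteq> 0"
    using trieD(9)[OF t] by blast
  have "mem a mod K < K" using trieD(2)[OF t] by simp
  then have "q = st s" "r = mem a mod K" using digits_unique[OF sa(1) r] by auto
  then show False
    using no sa(2,3) trieD(4)[OF t, of s] trieD(5)[OF t, of a] by auto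
qed

text \<open>The high digit of a cell is 0 or a state, hence at most \<open>cnt\<close>. This is what
  keeps additions to a cell from wrapping around.\<close>

lemma trie_mem_less:
  assumes "trie K cnt st mem rm W"
  shows "mem x < K * K"
proof -
  have "mem x div K < K"
    using trieD(2,4,8,9)[OF assms] by (metis le_less_trans not_gr_zero not_less_zero)
  then show ?thesis
    by (metis div_less_iff_less_mult gr_zeroI not_less_zero div_by_0 less_nat_zero_code)
qed

lemma table_position_less:
  fixes K :: nat
  assumes "q < K" "r < K"
  shows "q * K + r < K * K"
proof -
  have "q * K + r < Suc q * K" using assms(2) by simp
  also have "\<dots> \<le> K * K" using assms(1) by (intro mult_right_mono) auto
  finally show ?thesis .
qed

text \<open>A label without rank ends no string of the trie, and the column of the fresh rank is
  empty, so the new rank agrees with the transitions. As the low digit was 0, nothing is carried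
  into the high digit, which may already hold an unrelated transition.\<close>

lemma trie_add_label:
  assumes t: "trie K cnt st mem rm W" and new: "mem a mod K = 0" and cnt: "Suc cnt < K"
  shows "trie K (Suc cnt) st (mem(a := mem a + Suc cnt)) rm W"
proof -
  let ?m = "mem(a := mem a + Suc cnt)"
  have a: "?m a mod K = Suc cnt"
    using new cnt by (metis add.left_neutral fun_upd_same mod_add_left_eq mod_less)
  have b: "?m b mod K = mem b mod K" if "b \<noteq> a" for b using that by simp
  have d: "?m x div K = mem x div K" for x
  proof (cases "x = a")
    case True
    have "(mem a + Suc cnt) div K = mem a div K + Suc cnt div K + (mem a mod K + Suc cnt mod K) div K"
      by (rule div_add1_eq)
    then show ?thesis using new cnt True by simp
  qed simp
  have le: "?m b mod K \<le> Suc cnt" for b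
    using a b[of b] trieD(5)[OF t, of b] by (cases "b = a") auto
  have inj: "b = c" if "?m b mod K = ?m c mod K" "?m b mod K \<noteq> 0" for b c
    using that a b[of b] b[of c] trieD(7)[OF t, of b c] trieD(5)[OF t, of b] trieD(5)[OF t, of c]
    by (cases "b = a"; cases "c = a") (simp_all del: fun_upd_apply)
  \<comment> \<open>Label \<open>a\<close> still has rank 0 and so reads column 0, which is
    empty.\<close>
  have "mem (st s * K + mem a mod K) div K = 0" for s
    using trie_no_edge[OF t, of 0 "st s"] new cnt by simp
  then have nochild: "st (s @ [a]) = 0" for s using trieD(8)[OF t] by simp
  have edge: "?m (st s * K + ?m b mod K) div K = st (s @ [b])" for s b
    using a b[of b] d trieD(8)[OF t, of s b] trie_no_edge[OF t cnt] nochild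
    by (cases "b = a") (simp_all del: fun_upd_apply)
  have ex: "\<exists>s b. x = st s * K + ?m b mod K \<and> st s \<noteq> 0 \<and> ?m b mod K \<noteq> 0"
    if x: "?m x div K \<noteq> 0" for x
  proof -
    obtain s c where "x = st s * K + mem c mod K" "st s \<noteq> 0" "mem c mod K \<noteq> 0"
      using trieD(9)[OF t x[unfolded d]] by blast
    moreover from this have "c \<noteq> a" using new by auto
    ultimately have "x = st s * K + ?m c mod K \<and> st s \<noteq> 0 \<and> ?m c mod K \<noteq> 0"
      unfolding b[OF \<open>c \<noteq> a\<close>] by blast
    then show ?thesis by blast
  qed
  show ?thesis
  proof (rule trieI)
    show "st s \<le> Suc cnt" for s
      using trieD(4)[OF t] by (rule le_SucI)
    show "rm x = 0" if "x > Suc cnt" for x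
      using that trieD(10)[OF t] by simp
    show "b = c" if "?m b mod K = ?m c mod K" "?m b mod K \<noteq> 0" for b c
      by (rule inj[OF that])
    show "\<exists>s b. x = st s * K + ?m b mod K \<and> st s \<noteq> 0 \<and> ?m b mod K \<noteq> 0"
      if "?m x div K \<noteq> 0" for x
      by (rule ex[OF that])
    show "s = s'" if "st s = st s'" "st s \<noteq> 0" for s s'
      by (rule trieD(6)[OF t that])
  qed (rule cnt trieD(3)[OF t] trieD(11)[OF t] trieD(12)[OF t] le edge zero_less_Suc)+
qed

text \<open>Adding a multiple of \<open>K\<close> leaves all ranks alone. No other pair of state and
  label reads the changed cell, because a nonzero rank determines its label; and the row of the
  fresh state is empty, so the new string is a leaf.\<close>

lemma trie_add_state:
  assumes t: "trie K cnt st mem rm W" and cnt: "Suc cnt < K"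
    and s: "st s \<noteq> 0" and a: "mem a mod K \<noteq> 0" and new: "mem (st s * K + mem a mod K) div K = 0"
  shows "trie K (Suc cnt) (st(s @ [a] := Suc cnt))
     (mem(st s * K + mem a mod K := mem (st s * K + mem a mod K) + Suc cnt * K)) rm W"
proof -
  let ?c = "st s * K + mem a mod K"
  let ?m = "mem(?c := mem ?c + Suc cnt * K)"
  let ?st = "st(s @ [a] := Suc cnt)"
  have K: "0 < K" using cnt by simp
  have m: "?m b mod K = mem b mod K" for b
    by (cases "b = ?c") (simp_all only: fun_upd_same fun_upd_other mod_mult_self1 refl if_False
        not_False_eq_True simp_thms)
  have dc: "?m ?c div K = Suc cnt" using new K by (simp del: mult_Suc)
  have d: "?m x div K = mem x div K" if "x \<noteq> ?c" for x using that by simp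
  have st0: "st (s @ [a]) = 0" using new trieD(8)[OF t] by simp
  have c_eq: "q = st s \<and> b = a" if "q * K + mem b mod K = ?c" for q b
  proof -
    have "q = st s \<and> mem b mod K = mem a mod K"
      by (rule digits_unique[OF that]) (use K in auto)
    then show ?thesis using a trieD(7)[OF t, of b a] by simp
  qed
  have edge: "?m (?st u * K + ?m b mod K) div K = ?st (u @ [b])" for u b
  proof (cases "u = s @ [a]")
    case True
    have "Suc cnt * K + mem b mod K \<noteq> ?c"
      using c_eq[of "Suc cnt" b] trieD(4)[OF t, of s] by auto
    moreover have "mem (Suc cnt * K + mem b mod K) div K = 0"
      by (rule trie_no_edge[OF t]) (use K in auto)
    moreover have "st (u @ [b]) = 0"
      using trieD(8)[OF t, of u b] trie_no_edge[OF t, of "mem b mod K" 0] st0 True K by simp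
    ultimately show ?thesis unfolding m using True by simp
  next
    case u: False
    show ?thesis
    proof (cases "st u * K + mem b mod K = ?c")
      case True
      then have "st u = st s" "b = a" using c_eq by blast+
      then have "u = s" using s trieD(6)[OF t, of u s] by simp
      then show ?thesis unfolding m using dc u \<open>b = a\<close> by simp
    next
      case False
      then have "\<not> (u = s \<and> b = a)" by auto
      then show ?thesis unfolding m using u False trieD(8)[OF t, of u b] by auto
    qed
  qed
  have ex: "\<exists>u b. x = ?st u * K + ?m b mod K \<and> ?st u \<noteq> 0 \<and> ?m b mod K \<noteq> 0"
    if x: "?m x div K \<noteq> 0" for x
  proof (cases "x = ?c")
    case True
    then have "x = ?st s * K + ?m a mod K \<and> ?st s \<noteq> 0 \<and> ?m a mod K \<noteq> 0"
      unfolding m using s a by simp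
    then show ?thesis by blast
  next
    case False
    then obtain u b where u: "x = st u * K + mem b mod K" "st u \<noteq> 0" "mem b mod K \<noteq> 0"
      using trieD(9)[OF t x[unfolded d[OF False]]] by blast
    then have "u \<noteq> s @ [a]" using st0 by auto
    then have "x = ?st u * K + ?m b mod K \<and> ?st u \<noteq> 0 \<and> ?m b mod K \<noteq> 0"
      unfolding m using u by simp
    then show ?thesis by blast
  qed
  have inj: "u = v" if "?st u = ?st v" "?st u \<noteq> 0" for u v
    using that trieD(4)[OF t, of u] trieD(4)[OF t, of v] trieD(6)[OF t, of u v]
    by (auto split: if_splits)
  \<comment> \<open>The new string had state 0 and so weight \<open>rm 0 = 0\<close>, which is also
    the value stored at the fresh state.\<close>
  have W: "rm (?st u) = W u" for u
    using trieD(10)[OF t, of "Suc cnt"] trieD(11)[OF t] trieD(12)[OF t, of u]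
      trieD(12)[OF t, of "s @ [a]"] st0 by auto
  have le: "?st u \<le> Suc cnt" for u using trieD(4)[OF t, of u] by auto
  have nil: "?st [] = 1" using trieD(3)[OF t] by simp
  show ?thesis
  proof (rule trieI)
    show "?m b mod K \<le> Suc cnt" for b
      unfolding m using trieD(5)[OF t] by (rule le_SucI)
    show "b = c" if "?m b mod K = ?m c mod K" "?m b mod K \<noteq> 0" for b c
      using that unfolding m by (rule trieD(7)[OF t])
    show "rm x = 0" if "x > Suc cnt" for x
      using that trieD(10)[OF t] by simp
    show "u = v" if "?st u = ?st v" "?st u \<noteq> 0" for u v
      by (rule inj[OF that])
    show "\<exists>u b. x = ?st u * K + ?m b mod K \<and> ?st u \<noteq> 0 \<and> ?m b mod K \<noteq> 0"
      if "?m x div K \<noteq> 0" for x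
      by (rule ex[OF that])
  qed (rule cnt nil trieD(11)[OF t] W le edge zero_less_Suc)+
qed

text \<open>Nonzero states are not shared, so changing one cell changes the weight of one
  string.\<close>

lemma trie_add_weight:
  assumes t: "trie K cnt st mem rm W" and s: "st s \<noteq> 0"
  shows "trie K cnt st mem (rm(st s := rm (st s) + v)) (W(s := W s + v))"
proof -
  have W: "(rm(st s := rm (st s) + v)) (st u) = (W(s := W s + v)) u" for u
    using trieD(6)[OF t, of u s] trieD(12)[OF t] s by auto
  have fresh: "(rm(st s := rm (st s) + v)) x = 0" if "x > cnt" for x
    using that trieD(4)[OF t, of s] trieD(10)[OF t] by auto
  have dead: "(rm(st s := rm (st s) + v)) 0 = 0"
    using s trieD(11)[OF t] by simp
  show ?thesis
    by (rule trieI) (fact trieD(1-9)[OF t] W fresh dead)+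
qed

section \<open>Inserting the suffixes of a tree\<close>

text \<open>Register \<open>1\<close> stays unused because the simplifier rewrites \<open>1\<close> to \<open>Suc 0\<close>.\<close>

abbreviation (input) "rZero \<equiv> 0 :: nat"
abbreviation (input) "rBase \<equiv> 2 :: nat"
abbreviation (input) "rTrees \<equiv> 3 :: nat"
abbreviation (input) "rTree \<equiv> 4 :: nat"
abbreviation (input) "rPos \<equiv> 5 :: nat"
abbreviation (input) "rSize \<equiv> 6 :: nat"
abbreviation (input) "rNode \<equiv> 7 :: nat"
abbreviation (input) "rCur \<equiv> 8 :: nat"
abbreviation (input) "rState \<equiv> 9 :: nat"
abbreviation (input) "rAddr \<equiv> 10 :: nat"
abbreviation (input) "rLabel \<equiv> 11 :: nat"
abbreviation (input) "rVal \<equiv> 12 :: nat"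
abbreviation (input) "rRank \<equiv> 13 :: nat"
abbreviation (input) "rCell \<equiv> 14 :: nat"
abbreviation (input) "rCount \<equiv> 15 :: nat"
abbreviation (input) "rTmp \<equiv> 16 :: nat"
abbreviation (input) "rOne \<equiv> 17 :: nat"

abbreviation (input) "fAcc \<equiv> 0 :: nat"
abbreviation (input) "fPow \<equiv> 2 :: nat"
abbreviation (input) "fVal \<equiv> 3 :: nat"
abbreviation (input) "fLam \<equiv> 4 :: nat"

text \<open>There is no move instruction; adding \<open>rZero\<close> copies a register. Adding the
  rank to the cell sets its low digit, which is 0 in this branch.\<close>

definition find_rank :: com where
  "find_rank =
     Block [WLoad rVal rLabel, WOp WMod rRank rVal rBase] ;;
     IfEq rRank rZero
       (Block [WOp WAdd rCount rCount rOne, WOp WAdd rRank rCount rZero,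
               WOp WAdd rVal rVal rRank, WStore rLabel rVal])"

definition find_state :: com where
  "find_state =
     Block [WOp WMul rCell rState rBase, WOp WAdd rCell rCell rRank,
            WLoad rVal rCell, WOp WDiv rState rVal rBase] ;;
     IfEq rState rZero
       (Block [WOp WAdd rCount rCount rOne, WOp WAdd rState rCount rZero,
               WOp WMul rTmp rState rBase, WOp WAdd rVal rVal rTmp, WStore rCell rVal])"

text \<open>\<open>rCur\<close> holds a node number plus one, the form in which parents are encoded:
  0 ends the walk, and \<open>rPos + rCur\<close> is the position of the label because the size word
  comes first. The parent entry lies \<open>rSize\<close> further on. The power is multiplied up
  before it is added, since the string just reached is longer by one.\<close>

definition insert_step :: com where
  "insert_step =
     Block [WOp WAdd rAddr rPos rCur, WInput rLabel rAddr] ;;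
     find_rank ;; find_state ;;
     Block [ROp RMul fPow fPow fLam, RLoad fVal rState, ROp RAdd fVal fVal fPow,
            RStore rState fVal, WOp WAdd rAddr rAddr rSize, WInput rCur rAddr]"

definition kept :: "store \<Rightarrow> store \<Rightarrow> bool" where
  "kept s s' \<longleftrightarrow>
     (\<forall>r \<in> {rZero, rBase, rTrees, rTree, rPos, rSize, rNode, rOne}. wreg s' r = wreg s r) \<and>
     rreg s' fLam = rreg s fLam"

lemma wp_find_rank:
  assumes t: "trie K (wreg s rCount) st (wmem s) (rmem s) W"
    and regs: "wreg s rZero = 0" "wreg s rOne = 1" "wreg s rBase = K"
    and K: "Suc (wreg s rCount) < K" "K * K \<le> 2 ^ w"
    and Q: "\<And>k' s'. kept s s' \<Longrightarrow> trie K (wreg s' rCount) st (wmem s') (rmem s') W \<Longrightarrow>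
      wreg s' rCount \<le> Suc (wreg s rCount) \<Longrightarrow>
      wreg s' rRank = wmem s' (wreg s rLabel) mod K \<Longrightarrow> wreg s' rRank \<noteq> 0 \<Longrightarrow>
      wreg s' rState = wreg s rState \<Longrightarrow> wreg s' rAddr = wreg s rAddr \<Longrightarrow>
      rreg s' fPow = rreg s fPow \<Longrightarrow> Q k' s'"
  shows "wp w inp rinp find_rank Q k s"
proof -
  let ?a = "wreg s rLabel"
  have "K \<le> K * K" using K(1) by simp
  then have Kw: "K \<le> 2 ^ w" using K(2) by linarith
  have m: "wmem s ?a mod K mod 2 ^ w = wmem s ?a mod K"
    by (rule mod_less, rule less_le_trans[OF _ Kw]) (use K(1) in simp)
  have c: "Suc (wreg s rCount) mod 2 ^ w = Suc (wreg s rCount)"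
    by (rule mod_less, rule less_le_trans[OF K(1) Kw])
  show ?thesis
  proof (cases "wmem s ?a mod K = 0")
    case True
    have t': "trie K (Suc (wreg s rCount)) st
        ((wmem s)(?a := wmem s ?a + Suc (wreg s rCount))) (rmem s) W"
      by (rule trie_add_label[OF t True K(1)])
    \<comment> \<open>The sum is a cell of the updated trie, so the bound on the cells of
      \<open>t'\<close> excludes a wrap-around.\<close>
    have "wmem s ?a + Suc (wreg s rCount) < 2 ^ w"
      using trie_mem_less[OF t', of ?a] K(2) by simp
    then have v: "Suc (wmem s ?a + wreg s rCount) mod 2 ^ w = wmem s ?a + Suc (wreg s rCount)"
      by simp
    have "(wmem s ?a + Suc (wreg s rCount)) mod K = Suc (wreg s rCount)"
      using True K(1) by (metis add.left_neutral mod_add_left_eq mod_less)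
    then show ?thesis
      unfolding find_rank_def using regs m c v True t'
      by (simp, intro Q) (simp_all add: kept_def)
  next
    case False
    then show ?thesis
      unfolding find_rank_def using regs m t
      by (simp, intro Q) (simp_all add: kept_def)
  qed
qed

lemma wp_find_state:
  assumes t: "trie K (wreg s rCount) st (wmem s) (rmem s) W"
    and regs: "wreg s rZero = 0" "wreg s rOne = 1" "wreg s rBase = K"
    and st: "wreg s rState = st p" "st p \<noteq> 0"
    and rank: "wreg s rRank = wmem s a mod K" "wreg s rRank \<noteq> 0"
    and K: "Suc (wreg s rCount) < K" "K * K \<le> 2 ^ w"
    and Q: "\<And>k' s' st'. kept s s' \<Longrightarrow> trie K (wreg s' rCount) st' (wmem s') (rmem s') W \<Longrightarrow>
      wreg s' rCount \<le> Suc (wreg s rCount) \<Longrightarrow>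
      wreg s' rState = st' (p @ [a]) \<Longrightarrow> wreg s' rState \<noteq> 0 \<Longrightarrow> wreg s' rAddr = wreg s rAddr \<Longrightarrow>
      rreg s' fPow = rreg s fPow \<Longrightarrow> Q k' s'"
  shows "wp w inp rinp find_state Q k s"
proof -
  let ?c = "st p * K + wmem s a mod K"
  have "K \<le> K * K" using K(1) by simp
  then have Kw: "K \<le> 2 ^ w" using K(2) by linarith
  have stK: "st p < K" using trieD(2)[OF t] trieD(4)[OF t, of p] by simp
  have "?c < 2 ^ w"
    by (rule less_le_trans[OF table_position_less K(2)]) (use K stK in auto)
  then have c: "st p * K mod 2 ^ w = st p * K" "?c mod 2 ^ w = ?c"
    by (simp_all add: mod_less)
  have d: "wmem s ?c div K = st (p @ [a])" by (rule trieD(8)[OF t])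
  have dw: "st (p @ [a]) mod 2 ^ w = st (p @ [a])"
    by (rule mod_less, rule less_le_trans[OF _ Kw])
      (use trieD(2)[OF t] trieD(4)[OF t, of "p @ [a]"] in simp)
  have n: "Suc (wreg s rCount) mod 2 ^ w = Suc (wreg s rCount)"
    by (rule mod_less, rule less_le_trans[OF K(1) Kw])
  show ?thesis
  proof (cases "st (p @ [a]) = 0")
    case True
    let ?n = "Suc (wreg s rCount)"
    have t': "trie K ?n (st(p @ [a] := ?n)) ((wmem s)(?c := wmem s ?c + ?n * K)) (rmem s) W"
      by (rule trie_add_state[OF t K(1) st(2)]) (use rank d True in simp_all)
    have lt: "wmem s ?c + ?n * K < 2 ^ w"
      using trie_mem_less[OF t', of ?c] K(2) by simp
    then have "?n * K mod 2 ^ w = ?n * K" "(wmem s ?c + ?n * K) mod 2 ^ w = wmem s ?c + ?n * K"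
      by (simp_all add: mod_less del: mult_Suc)
    then show ?thesis
      unfolding find_state_def using regs st(1) rank(1) c d dw n True t'
      by (simp del: mult_Suc, intro Q[where st' = "st(p @ [a] := ?n)"])
        (simp_all add: kept_def del: mult_Suc)
  next
    case False
    then show ?thesis
      unfolding find_state_def using regs st(1) rank(1) c d dw t
      by (simp, intro Q[where st' = st]) (simp_all add: kept_def)
  qed
qed

definition parent_word :: "'a ltree \<Rightarrow> nat \<Rightarrow> nat" where
  "parent_word T i = (case parent T i of None \<Rightarrow> 0 | Some p \<Rightarrow> Suc p)"

text \<open>The offset \<open>b\<close> lets one description serve both a tree inside the forest
  encoding and a query tree at 0. The first bound makes every input position of the tree a
  word.\<close>

definition tree_at :: "('a \<Rightarrow> nat) \<Rightarrow> nat \<Rightarrow> nat list \<Rightarrow> nat \<Rightarrow> 'a ltree \<Rightarrow> bool" where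
  "tree_at code w inp b T \<longleftrightarrow>
     b + 2 * length T < 2 ^ w \<and> read_input inp b = length T \<and>
     (\<forall>i < length T. read_input inp (b + Suc i) = code (label T i) \<and> code (label T i) < 2 ^ w \<and>
        read_input inp (b + Suc i + length T) = parent_word T i \<and> parent_word T i \<le> length T)"

lemma wp_insert_step:
  assumes t: "trie K (wreg s rCount) st (wmem s) (rmem s) W"
    and regs: "wreg s rZero = 0" "wreg s rOne = 1" "wreg s rBase = K"
      "wreg s rPos = b" "wreg s rSize = length T" "wreg s rCur = Suc i"
    and T: "tree_at code w inp b T" "i < length T"
    and st: "wreg s rState = st p" "st p \<noteq> 0"
    and K: "wreg s rCount + 2 < K" "K * K \<le> 2 ^ w"
    and Q: "\<And>k' s' st'. kept s s' \<Longrightarrow> trie K (wreg s' rCount) st' (wmem s') (rmem s')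
        (W(p @ [code (label T i)] := W (p @ [code (label T i)]) + rreg s fPow * rreg s fLam)) \<Longrightarrow>
      wreg s' rCount \<le> wreg s rCount + 2 \<Longrightarrow>
      wreg s' rState = st' (p @ [code (label T i)]) \<Longrightarrow> wreg s' rState \<noteq> 0 \<Longrightarrow>
      wreg s' rCur = parent_word T i \<Longrightarrow>
      rreg s' fPow = rreg s fPow * rreg s fLam \<Longrightarrow> Q k' s'"
  shows "wp w inp rinp insert_step Q k s"
proof -
  let ?a = "code (label T i)"
  have bnd: "(b + Suc i) mod 2 ^ w = b + Suc i"
    "(b + Suc i + length T) mod 2 ^ w = b + Suc i + length T"
    using T unfolding tree_at_def by (simp_all add: mod_less)
  have inp: "read_input inp (b + Suc i) mod 2 ^ w = ?a"
    "read_input inp (b + Suc i + length T) mod 2 ^ w = parent_word T i"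
    using T unfolding tree_at_def by (auto simp: mod_less)
  let ?B = "Block [ROp RMul fPow fPow fLam, RLoad fVal rState, ROp RAdd fVal fVal fPow,
            RStore rState fVal, WOp WAdd rAddr rAddr rSize, WInput rCur rAddr]"
  let ?s1 = "s\<lparr>wreg := (wreg s)(rAddr := b + Suc i, rLabel := ?a)\<rparr>"
  have "wp w inp rinp find_rank (wp w inp rinp (find_state ;; ?B) Q) (k + 2) ?s1"
  proof (rule wp_find_rank[where K = K and st = st and W = W])
    fix k2 s2
    assume k2: "kept ?s1 s2" and t2: "trie K (wreg s2 rCount) st (wmem s2) (rmem s2) W"
      and c2: "wreg s2 rCount \<le> Suc (wreg ?s1 rCount)"
      and r2: "wreg s2 rRank = wmem s2 (wreg ?s1 rLabel) mod K" "wreg s2 rRank \<noteq> 0"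
      and o2: "wreg s2 rState = wreg ?s1 rState" "wreg s2 rAddr = wreg ?s1 rAddr"
        "rreg s2 fPow = rreg ?s1 fPow"
    have "wp w inp rinp find_state (wp w inp rinp ?B Q) k2 s2"
    proof (rule wp_find_state[where K = K and st = st and W = W and a = ?a and p = p])
      fix k3 s3 st3
      assume k3: "kept s2 s3" and t3: "trie K (wreg s3 rCount) st3 (wmem s3) (rmem s3) W"
        and c3: "wreg s3 rCount \<le> Suc (wreg s2 rCount)"
        and r3: "wreg s3 rState = st3 (p @ [?a])" "wreg s3 rState \<noteq> 0"
        and o3: "wreg s3 rAddr = wreg s2 rAddr" "rreg s3 fPow = rreg s2 fPow"
      have t4: "trie K (wreg s3 rCount) st3 (wmem s3)
          ((rmem s3)(st3 (p @ [?a]) := rmem s3 (st3 (p @ [?a])) + rreg s fPow * rreg s fLam))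
          (W(p @ [?a] := W (p @ [?a]) + rreg s fPow * rreg s fLam))"
        by (rule trie_add_weight[OF t3]) (use r3 in simp)
      have addr: "wreg s3 rAddr = b + Suc i" and size: "wreg s3 rSize = length T"
        and pow: "rreg s3 fPow = rreg s fPow" and lam: "rreg s3 fLam = rreg s fLam"
        using k2 k3 o2 o3 regs by (simp_all add: kept_def)
      note upd = bnd(2) inp(2) addr size pow lam r3(1)
      show "wp w inp rinp ?B Q k3 s3"
        using k2 k3 c2 c3 r3 t4
        by (simp add: upd del: add_Suc_right add_Suc, intro Q[where st' = st3])
          (simp_all add: kept_def upd)
    qed (use k2 t2 r2 o2 regs st K c2 in \<open>simp_all add: kept_def\<close>)
    then show "wp w inp rinp (find_state ;; ?B) Q k2 s2" by simp
  qed (use t regs K in simp_all)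
  then show ?thesis
    unfolding insert_step_def using regs(4,6) bnd(1) inp(1) by simp
qed

text \<open>\<open>p\<close> is the string already read and \<open>u\<close> the rest up to the
  root; the induction follows \<open>u\<close>, with trie and weights general because each step
  changes both. A node consumes at most two fresh numbers, a rank and a state. The clock
  \<open>k'\<close> stays unconstrained, as preprocessing is not timed.\<close>

lemma wp_insert_walk:
  assumes "up_string T i u" "i < length T"
    and T: "tree_at code w inp b T"
    and K2: "K * K \<le> 2 ^ w"
  shows "trie K (wreg s rCount) st (wmem s) (rmem s) W \<Longrightarrow>
     wreg s rZero = 0 \<Longrightarrow> wreg s rOne = 1 \<Longrightarrow> wreg s rBase = K \<Longrightarrow>
     wreg s rPos = b \<Longrightarrow> wreg s rSize = length T \<Longrightarrow> wreg s rCur = Suc i \<Longrightarrow>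
     wreg s rState = st p \<Longrightarrow> st p \<noteq> 0 \<Longrightarrow> wreg s rCount + 2 * length u < K \<Longrightarrow>
     rreg s fPow = \<alpha> * rreg s fLam ^ length p \<Longrightarrow>
     (\<And>k' s' st'. kept s s' \<Longrightarrow> wreg s' rCount \<le> wreg s rCount + 2 * length u \<Longrightarrow>
        trie K (wreg s' rCount) st' (wmem s') (rmem s')
          (\<lambda>x. W x + (if strict_prefix p x \<and> prefix x (p @ map code u)
                       then \<alpha> * rreg s fLam ^ length x else 0)) \<Longrightarrow> Q k' s') \<Longrightarrow>
     wp w inp rinp (WhileNe rCur rZero insert_step) Q k s"
  using assms(1,2)
proof (induction arbitrary: p s st W k rule: up_string.induct)
  case (root i)
  note loop = wp_WhileNe[of w inp rinp rCur rZero insert_step Q]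
  let ?a = "code (label T i)"
  have pw: "parent_word T i = 0" using root.hyps by (simp add: parent_word_def)
  have "wp w inp rinp insert_step (\<lambda>k'. wp w inp rinp (WhileNe rCur rZero insert_step) Q (Suc k'))
      (Suc k) s"
  proof (rule wp_insert_step[OF root.prems(1-7) T root.prems(13,8,9) _ K2])
    fix k' s' st'
    assume s': "kept s s'" "wreg s' rCount \<le> wreg s rCount + 2" "wreg s' rCur = parent_word T i"
      and t': "trie K (wreg s' rCount) st' (wmem s') (rmem s')
        (W(p @ [?a] := W (p @ [?a]) + rreg s fPow * rreg s fLam))"
    have "W(p @ [?a] := W (p @ [?a]) + rreg s fPow * rreg s fLam) =
        (\<lambda>x. W x + (if strict_prefix p x \<and> prefix x (p @ map code [label T i])
                     then \<alpha> * rreg s fLam ^ length x else 0))"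
      using root.prems(11) by (auto simp: fun_eq_iff strict_prefix_def)
    then have "Q (Suc (Suc k')) s'"
      using s' t' by (intro root.prems(12)) simp_all
    then show "wp w inp rinp (WhileNe rCur rZero insert_step) Q (Suc k') s'"
      using s' pw root.prems(2) by (subst loop) (simp add: kept_def)
  qed (use root.prems(10) in simp)
  then show ?case using root.prems(2,7) by (subst loop) simp
next
  case (step i q u)
  note loop = wp_WhileNe[of w inp rinp rCur rZero insert_step Q]
  let ?a = "code (label T i)"
  have pw: "parent_word T i = Suc q" using step.hyps by (simp add: parent_word_def)
  then have q: "q < length T" using T step.prems(13) unfolding tree_at_def by auto
  have "wp w inp rinp insert_step (\<lambda>k'. wp w inp rinp (WhileNe rCur rZero insert_step) Q (Suc k'))
      (Suc k) s"
  proof (rule wp_insert_step[OF step.prems(1-7) T step.prems(13,8,9) _ K2])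
    fix k' s' st'
    assume s': "kept s s'" "wreg s' rCount \<le> wreg s rCount + 2"
      "wreg s' rState = st' (p @ [?a])" "wreg s' rState \<noteq> 0"
      "wreg s' rCur = parent_word T i" "rreg s' fPow = rreg s fPow * rreg s fLam"
      and t': "trie K (wreg s' rCount) st' (wmem s') (rmem s')
        (W(p @ [?a] := W (p @ [?a]) + rreg s fPow * rreg s fLam))"
    show "wp w inp rinp (WhileNe rCur rZero insert_step) Q (Suc k') s'"
    proof (rule step.IH[OF t', of "p @ [?a]"])
      fix k2 s2 st2
      assume s2: "kept s' s2" "wreg s2 rCount \<le> wreg s' rCount + 2 * length u"
        and t2: "trie K (wreg s2 rCount) st2 (wmem s2) (rmem s2)
          (\<lambda>x. (W(p @ [?a] := W (p @ [?a]) + rreg s fPow * rreg s fLam)) x +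
            (if strict_prefix (p @ [?a]) x \<and> prefix x ((p @ [?a]) @ map code u)
             then \<alpha> * rreg s' fLam ^ length x else 0))"
      have lam: "rreg s' fLam = rreg s fLam" using s'(1) by (simp add: kept_def)
      \<comment> \<open>The prefixes strictly beyond \<open>p\<close> are \<open>p @ [?a]\<close>
        and those strictly beyond \<open>p @ [?a]\<close>.\<close>
      have "(\<lambda>x. (W(p @ [?a] := W (p @ [?a]) + rreg s fPow * rreg s fLam)) x +
            (if strict_prefix (p @ [?a]) x \<and> prefix x ((p @ [?a]) @ map code u)
             then \<alpha> * rreg s' fLam ^ length x else 0)) =
          (\<lambda>x. W x + (if strict_prefix p x \<and> prefix x (p @ map code (label T i # u))
             then \<alpha> * rreg s fLam ^ length x else 0))"
        unfolding lam
        using step.prems(11)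
        by (auto simp: fun_eq_iff strict_prefix_def prefix_def append_eq_append_conv2
            append_eq_Cons_conv Cons_eq_append_conv)
      then show "Q k2 s2"
        using s' s2 t2 by (intro step.prems(12)) (simp_all add: kept_def)
    qed (use s' pw q step.prems in \<open>simp_all add: kept_def\<close>)
  qed (use step.prems(10) in simp)
  then show ?case using step.prems(2,7) by (subst loop) simp
qed

section \<open>Paths in rooted trees\<close>

lemma rooted_tree_parent:
  assumes "rooted_tree \<Sigma> T" "i < length T" "parent T i = Some p"
  shows "p < length T"
proof -
  obtain r where r: "parent T r = None" "(i, r) \<in> (parent_rel T)\<^sup>*"
    using assms unfolding rooted_tree_def by blast
  then have "i \<noteq> r" using assms(3) by auto
  then obtain q where "(i, q) \<in> parent_rel T" using r(2) by (meson converse_rtranclE)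
  then show ?thesis using assms(3) unfolding parent_rel_def by simp
qed

text \<open>Moving to a parent drops the first character. This serves to exclude that a node is its
  own proper ancestor.\<close>

lemma up_string_reachable_length:
  assumes "(i, j) \<in> (parent_rel T)\<^sup>*" "up_string T i s" "up_string T j s'"
  shows "length s' \<le> length s"
  using assms
proof (induction arbitrary: s rule: converse_rtrancl_induct)
  case base
  then show ?case using up_string_unique by blast
next
  case (step i p)
  from step.prems(1) step.hyps(1) obtain u where "up_string T p u" "s = label T i # u"
    by (cases rule: up_string.cases) (auto simp: parent_rel_def)
  then show ?case using step.IH[OF _ step.prems(2)] by fastforce
qed

text \<open>The nodes on the way to the root are distinct, so a walk visits no more nodes than the
  tree has: the source of the quadratic bound.\<close>

lemma up_string_length_le_ancestors:
  assumes T: "rooted_tree \<Sigma> T" and "up_string T i s" "i < length T"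
  shows "length s \<le> card {j. j < length T \<and> (i, j) \<in> (parent_rel T)\<^sup>*}"
  using assms(2,3)
proof induction
  case (root i)
  then have "i \<in> {j. j < length T \<and> (i, j) \<in> (parent_rel T)\<^sup>*}" by simp
  then have "0 < card {j. j < length T \<and> (i, j) \<in> (parent_rel T)\<^sup>*}"
    by (intro card_gt_0_iff[THEN iffD2]) auto
  then show ?case by simp
next
  case (step i p s)
  let ?A = "\<lambda>i. {j. j < length T \<and> (i, j) \<in> (parent_rel T)\<^sup>*}"
  have p: "p < length T" using rooted_tree_parent[OF T step.prems step.hyps(1)] .
  have ip: "(i, p) \<in> parent_rel T" using step p by (simp add: parent_rel_def)
  \<comment> \<open>Otherwise the string of \<open>i\<close> would be no longer than that of
    \<open>p\<close>, although it has one character more.\<close>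
  have "(p, i) \<notin> (parent_rel T)\<^sup>*"
    using up_string_reachable_length[OF _ step.hyps(2) up_string.step[OF step.hyps]] by auto
  then have "i \<notin> ?A p" by simp
  then have "Suc (card (?A p)) = card (insert i (?A p))" by simp
  also have "\<dots> \<le> card (?A i)"
    using step.prems ip by (intro card_mono) (auto intro: converse_rtrancl_into_rtrancl)
  finally show ?case using step.IH[OF p] by simp
qed

lemma length_node_suffix:
  assumes "rooted_tree \<Sigma> T" "i < length T"
  shows "length (node_suffix T i) \<le> length T"
proof -
  have "length (node_suffix T i) \<le> card {j. j < length T \<and> (i, j) \<in> (parent_rel T)\<^sup>*}"
    by (rule up_string_length_le_ancestors[OF assms(1) up_string_node_suffix[OF assms] assms(2)])
  also have "\<dots> \<le> card {..<length T}" by (rule card_mono) auto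
  finally show ?thesis by simp
qed

lemma set_node_suffix:
  assumes T: "rooted_tree \<Sigma> T" and i: "i < length T"
  shows "set (node_suffix T i) \<subseteq> \<Sigma>"
  using up_string_node_suffix[OF T i] i
proof (induction rule: up_string.induct)
  case (root i)
  then show ?case using T unfolding rooted_tree_def by simp
next
  case (step i p s)
  then show ?case using T rooted_tree_parent[OF T] unfolding rooted_tree_def by simp
qed

lemma length_encode_tree: "length (encode_tree code T) = Suc (2 * length T)"
  by (simp add: encode_tree_def)

lemma tree_at_encode:
  assumes T: "rooted_tree \<Sigma> T" and code: "\<forall>a \<in> \<Sigma>. code a < 2 ^ w"
    and len: "length pre + 2 * length T < 2 ^ w"
  shows "tree_at code w (pre @ encode_tree code T @ post) (length pre) T"
proof -
  have rd: "read_input (pre @ encode_tree code T @ post) (length pre + x) = encode_tree code T ! x"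
    if "x \<le> 2 * length T" for x
    using that by (simp add: read_input_def nth_append length_encode_tree)
  have lab: "label T i \<in> \<Sigma>" if "i < length T" for i
    using T that unfolding rooted_tree_def by blast
  have par: "parent_word T i \<le> length T" if "i < length T" for i
    using rooted_tree_parent[OF T that] by (auto simp: parent_word_def split: option.split)
  have "encode_tree code T ! Suc i = code (label T i)"
    "encode_tree code T ! (Suc i + length T) = parent_word T i" if "i < length T" for i
    using that
    by (auto simp: encode_tree_def nth_append label_def parent_def parent_word_def case_prod_beta)
  then show ?thesis
    unfolding tree_at_def using rd[of 0] rd[of "Suc _"] rd[of "Suc _ + length T"] len lab par code
    by (auto simp: encode_tree_def add.assoc)
qed

section \<open>Preprocessing\<close>

text \<open>The power register starts at the weight of the tree instead of 1, so each string
  receives \<open>\<alpha> * lam ^ length s\<close> at once. Real input position 0 holds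
  \<open>lam\<close> and \<open>rTree\<close> has already been advanced, so position
  \<open>rTree\<close> is that weight.\<close>

definition insert_tree :: com where
  "insert_tree =
     Block [WOp WAdd rNode rZero rZero] ;;
     WhileNe rNode rSize
       (Block [WOp WAdd rNode rNode rOne, WOp WAdd rCur rNode rZero,
               WOp WAdd rState rOne rZero, RInput fPow rTree] ;;
        WhileNe rCur rZero insert_step)"

definition node_weight :: "('a \<Rightarrow> nat) \<Rightarrow> real \<Rightarrow> real \<Rightarrow> 'a ltree \<Rightarrow> nat \<Rightarrow> nat list \<Rightarrow> real" where
  "node_weight code lam \<alpha> T i s =
     (if s \<noteq> [] \<and> prefix s (map code (node_suffix T i)) then \<alpha> * lam ^ length s else 0)"

text \<open>The budget: one walk per node, each of at most \<open>length T\<close> steps, with two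
  fresh numbers per step.\<close>

lemma wp_insert_tree:
  assumes T: "rooted_tree \<Sigma> T" "tree_at code w inp b T"
    and t: "trie K (wreg s rCount) st (wmem s) (rmem s) W"
    and regs: "wreg s rZero = 0" "wreg s rOne = 1" "wreg s rBase = K"
      "wreg s rPos = b" "wreg s rSize = length T"
    and reals: "rreg s fLam = lam" "read_input rinp (wreg s rTree) = \<alpha>"
    and K: "wreg s rCount + 2 * length T * length T < K" "K * K \<le> 2 ^ w"
    and Q: "\<And>k' s' st'. rreg s' fLam = lam \<Longrightarrow>
      \<forall>r \<in> {rZero, rOne, rBase, rTrees, rTree, rPos, rSize}. wreg s' r = wreg s r \<Longrightarrow>
      trie K (wreg s' rCount) st' (wmem s') (rmem s')
        (\<lambda>x. W x + (\<Sum>i<length T. node_weight code lam \<alpha> T i x)) \<Longrightarrow>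
      wreg s' rCount \<le> wreg s rCount + 2 * length T * length T \<Longrightarrow> Q k' s'"
  shows "wp w inp rinp insert_tree Q k s"
proof -
  let ?n = "length T"
  define I where "I = (\<lambda>i (k :: nat) (s' :: store). rreg s' fLam = lam \<and> wreg s' rNode = i \<and>
     (\<forall>r \<in> {rZero, rOne, rBase, rTrees, rTree, rPos, rSize}. wreg s' r = wreg s r) \<and>
     (\<exists>st'. trie K (wreg s' rCount) st' (wmem s') (rmem s')
        (\<lambda>x. W x + (\<Sum>j<i. node_weight code lam \<alpha> T j x))) \<and>
     wreg s' rCount \<le> wreg s rCount + 2 * ?n * i)"
  have n: "b + 2 * ?n < 2 ^ w" using T(2) unfolding tree_at_def by blast
  let ?body = "Block [WOp WAdd rNode rNode rOne, WOp WAdd rCur rNode rZero,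
               WOp WAdd rState rOne rZero, RInput fPow rTree] ;;
        WhileNe rCur rZero insert_step"
  have "wp w inp rinp (WhileNe rNode rSize ?body) Q (Suc k) (s\<lparr>wreg := (wreg s)(rNode := 0)\<rparr>)"
  proof (rule wp_for[where I = I and n = ?n])
    show "I 0 (Suc k) (s\<lparr>wreg := (wreg s)(rNode := 0)\<rparr>)"
      unfolding I_def using t reals by auto
  next
    fix k s' assume "I ?n k s'"
    then show "wreg s' rNode = wreg s' rSize \<and> Q (Suc k) s'"
      unfolding I_def using regs by (auto intro: Q)
  next
    fix i k1 s1 assume i: "i < ?n" and I: "I i k1 s1"
    then obtain st1 where t1: "trie K (wreg s1 rCount) st1 (wmem s1) (rmem s1)
        (\<lambda>x. W x + (\<Sum>j<i. node_weight code lam \<alpha> T j x))"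
      unfolding I_def by blast
    have r1: "wreg s1 rNode = i" "rreg s1 fLam = lam" "wreg s1 rZero = 0" "wreg s1 rOne = 1"
      "wreg s1 rBase = K" "wreg s1 rTrees = wreg s rTrees" "wreg s1 rTree = wreg s rTree"
      "wreg s1 rPos = b" "wreg s1 rSize = ?n"
      and c1: "wreg s1 rCount \<le> wreg s rCount + 2 * ?n * i"
      using I regs unfolding I_def by simp_all
    have "Suc i < 2 ^ w" "Suc 0 < 2 ^ w" using i n by linarith+
    note md = this[THEN mod_less]
    let ?u = "node_suffix T i"
    have u: "length ?u \<le> ?n" by (rule length_node_suffix[OF T(1) i])
    have "2 * ?n * i + 2 * ?n = 2 * ?n * Suc i" by simp
    also have "\<dots> \<le> 2 * ?n * ?n" using i by (intro mult_left_mono) auto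
    finally have ni: "2 * ?n * i + 2 * ?n \<le> 2 * ?n * ?n" .
    let ?s2 = "s1\<lparr>wreg := (wreg s1)(rNode := Suc i, rCur := Suc i, rState := 1),
        rreg := (rreg s1)(fPow := \<alpha>)\<rparr>"
    have "wp w inp rinp (WhileNe rCur rZero insert_step) (\<lambda>k'. I (Suc i) (Suc k')) (Suc (Suc (Suc (Suc (Suc k1))))) ?s2"
    proof (rule wp_insert_walk[OF up_string_node_suffix[OF T(1) i] i T(2) K(2),
          where st = st1 and p = "[]" and \<alpha> = \<alpha>])
      fix k' s' st'
      assume s': "kept ?s2 s'" "wreg s' rCount \<le> wreg ?s2 rCount + 2 * length ?u"
        and t': "trie K (wreg s' rCount) st' (wmem s') (rmem s')
          (\<lambda>x. W x + (\<Sum>j<i. node_weight code lam \<alpha> T j x) +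
            (if strict_prefix [] x \<and> prefix x ([] @ map code ?u)
             then \<alpha> * rreg ?s2 fLam ^ length x else 0))"
      have "(\<lambda>x. W x + (\<Sum>j<i. node_weight code lam \<alpha> T j x) +
            (if strict_prefix [] x \<and> prefix x ([] @ map code ?u)
             then \<alpha> * rreg ?s2 fLam ^ length x else 0)) =
          (\<lambda>x. W x + (\<Sum>j<Suc i. node_weight code lam \<alpha> T j x))"
        using r1(2) by (auto simp: fun_eq_iff node_weight_def strict_prefix_def)
      then show "I (Suc i) (Suc k') s'"
        unfolding I_def using s' t' c1 r1 regs u by (auto simp: kept_def)
    qed (use t1 r1 trieD(3)[OF t1] c1 ni u K(1) in simp_all)
    then show "wreg s1 rNode \<noteq> wreg s1 rSize \<and>
        wp w inp rinp ?body (\<lambda>k'. I (Suc i) (Suc k')) (Suc k1) s1"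
      using i r1 md reals(2) by simp
  qed
  then show ?thesis unfolding insert_tree_def using regs by simp
qed

text \<open>There are two passes because the base depends on the total size and must be fixed before
  the first cell is packed. \<open>rPos\<close> starts at 1, behind the number of trees.\<close>

definition preprocess_com :: com where
  "preprocess_com =
     Block [WConst rOne 1, WInput rTrees rZero, WOp WAdd rPos rOne rZero, WConst rBase 2,
            WOp WAdd rTree rZero rZero] ;;
     WhileNe rTree rTrees
       (Block [WOp WAdd rTree rTree rOne, WInput rSize rPos, WOp WAdd rBase rBase rSize,
               WOp WAdd rBase rBase rSize, WOp WAdd rPos rPos rSize, WOp WAdd rPos rPos rSize,
               WOp WAdd rPos rPos rOne]) ;;
     Block [WOp WMul rBase rBase rBase, WOp WAdd rPos rOne rZero, WOp WAdd rTree rZero rZero,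
            WOp WAdd rCount rOne rZero, RInput fLam rZero] ;;
     WhileNe rTree rTrees
       (Block [WOp WAdd rTree rTree rOne, WInput rSize rPos] ;;
        insert_tree ;;
        Block [WOp WAdd rPos rPos rSize, WOp WAdd rPos rPos rSize, WOp WAdd rPos rPos rOne])"

definition forest_weight ::
  "('a \<Rightarrow> nat) \<Rightarrow> real \<Rightarrow> 'a ltree list \<Rightarrow> real list \<Rightarrow> nat \<Rightarrow> nat list \<Rightarrow> real" where
  "forest_weight code lam Ts \<alpha>s m s =
     (\<Sum>j<m. \<Sum>i<length (Ts ! j). node_weight code lam (\<alpha>s ! j) (Ts ! j) i s)"

section \<open>Positions, sizes and word-length bounds of the encoded forest\<close>

lemma encode_forest_split:
  assumes "j < length Ts"
  shows "\<exists>pre post. encode_forest code Ts = pre @ encode_tree code (Ts ! j) @ post \<and>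
    length pre = length (encode_forest code (take j Ts))"
proof -
  have "Ts = take j Ts @ Ts ! j # drop (Suc j) Ts" using assms by (rule id_take_nth_drop)
  then have "concat (map (encode_tree code) Ts) =
      concat (map (encode_tree code) (take j Ts)) @ encode_tree code (Ts ! j) @
      concat (map (encode_tree code) (drop (Suc j) Ts))"
    by (metis concat.simps(2) concat_append list.simps(9) map_append)
  then show ?thesis
    unfolding encode_forest_def
    by (intro exI[of _ "length Ts # concat (map (encode_tree code) (take j Ts))"]
        exI[of _ "concat (map (encode_tree code) (drop (Suc j) Ts))"]) simp
qed

lemma length_encode_forest:
  "length (encode_forest code Ts) = Suc (2 * sum_list (map length Ts) + length Ts)"
proof -
  have "length (concat (map (encode_tree code) Ts)) = 2 * sum_list (map length Ts) + length Ts"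
    by (induction Ts) (simp_all add: length_encode_tree)
  then show ?thesis by (simp add: encode_forest_def)
qed

lemma length_encode_forest_take_Suc:
  "j < length Ts \<Longrightarrow> length (encode_forest code (take (Suc j) Ts)) =
     length (encode_forest code (take j Ts)) + Suc (2 * length (Ts ! j))"
  unfolding length_encode_forest by (simp add: take_Suc_conv_app_nth)

lemma sum_list_length_take:
  fixes Ts :: "'b list list"
  shows "sum_list (map length (take j Ts)) \<le> sum_list (map length Ts)"
proof -
  have "sum_list (map length Ts) =
      sum_list (map length (take j Ts)) + sum_list (map length (drop j Ts))"
    by (metis append_take_drop_id map_append sum_list_append)
  then show ?thesis by simp
qed

text \<open>The word length is tied to the number of nodes only. As rooted trees are nonempty, the
  number of trees, which also enters input positions, is bounded by it too.\<close>

lemma length_le_sum_list_length: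
  assumes "\<forall>T \<in> set Ts. T \<noteq> []"
  shows "length Ts \<le> sum_list (map length Ts)"
  using assms
proof (induction Ts)
  case (Cons T Ts)
  then show ?case by (cases T) auto
qed simp

text \<open>\<open>B * B\<close> is the base of the trie, so cells and positions need
  \<open>B ^ 4\<close>. Since \<open>B \<le> 2 * (N + 2)\<close> and \<open>2 \<le> N + 2\<close>,
  eight factors \<open>N + 2\<close> suffice. The second bound covers input positions: two words per
  node and a size word per tree, behind the leading count.\<close>

lemma trie_base_bound:
  fixes N w :: nat
  assumes "(N + 2) ^ 8 \<le> 2 ^ w"
  defines "B \<equiv> 2 + 2 * N"
  shows "(B * B) * (B * B) \<le> 2 ^ w" "3 * N + 3 < 2 ^ w"
proof -
  have B: "B \<le> 2 * (N + 2)" unfolding B_def by simp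
  have "(B * B) * (B * B) = B ^ 4" by (simp add: power4_eq_xxxx)
  also have "\<dots> \<le> (2 * (N + 2)) ^ 4" by (rule power_mono[OF B]) simp
  also have "\<dots> = 2 ^ 4 * (N + 2) ^ 4" by (rule power_mult_distrib)
  also have "\<dots> \<le> (N + 2) ^ 4 * (N + 2) ^ 4" by (intro mult_right_mono power_mono) auto
  also have "\<dots> = (N + 2) ^ 8" by (simp flip: power_add)
  finally show "(B * B) * (B * B) \<le> 2 ^ w" using assms(1) by linarith
  have "3 * N + 3 < 2 ^ 7 * (N + 2)" by simp
  also have "\<dots> \<le> (N + 2) ^ 7 * (N + 2)" by (intro mult_right_mono power_mono) auto
  also have "\<dots> = (N + 2) ^ Suc 7" by (rule power_Suc2[symmetric])
  also have "\<dots> = (N + 2) ^ 8" by simp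
  finally show "3 * N + 3 < 2 ^ w" using assms(1) by linarith
qed

lemma wp_preprocess:
  fixes Ts :: "'a ltree list"
  assumes trees: "\<forall>T \<in> set Ts. rooted_tree \<Sigma> T" and code: "\<forall>a \<in> \<Sigma>. code a < 2 ^ w"
    and len: "length \<alpha>s = length Ts" and addr: "addressable 8 w Ts"
  shows "wp w (encode_forest code Ts) (lam # \<alpha>s) preprocess_com
     (\<lambda>_ D. wreg D rZero = 0 \<and> wreg D rOne = 1 \<and> wreg D rBase * wreg D rBase \<le> 2 ^ w \<and>
        (\<exists>st. trie (wreg D rBase) (wreg D rCount) st (wmem D) (rmem D)
           (forest_weight code lam Ts \<alpha>s (length Ts)))) 0 empty_store"
proof -
  define inp where "inp = encode_forest code Ts"
  define N where "N = sum_list (map length Ts)"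
  define B where "B = 2 + 2 * N"
  define S where "S j = sum_list (map length (take j Ts))" for j
  define pos where "pos j = length (encode_forest code (take j Ts))" for j
  let ?m = "length Ts" and ?n = "\<lambda>j. length (Ts ! j)"
  have BK: "(B * B) * (B * B) \<le> 2 ^ w" and w: "3 * N + 3 < 2 ^ w"
    using trie_base_bound[of N w] addr unfolding addressable_def B_def N_def by simp_all
  have Bm: "B * B mod 2 ^ w = B * B"
  proof (rule mod_less)
    have "B * B < (B * B) * (B * B)" unfolding B_def by (simp add: nat_less_le)
    then show "B * B < 2 ^ w" using BK by linarith
  qed
  have "T \<noteq> []" if "T \<in> set Ts" for T
    using trees that unfolding rooted_tree_def by fastforce
  then have mN: "?m \<le> N" unfolding N_def by (intro length_le_sum_list_length) blast
  have S0: "S 0 = 0" unfolding S_def by simp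
  have SS: "S (Suc j) = S j + ?n j" if "j < ?m" for j
    using that unfolding S_def by (simp add: take_Suc_conv_app_nth)
  have SN: "S j \<le> N" for j unfolding S_def N_def by (rule sum_list_length_take)
  have Sm: "S ?m = N" unfolding S_def N_def by simp
  have pos0: "pos 0 = 1" unfolding pos_def by (simp add: encode_forest_def)
  have posS: "pos (Suc j) = Suc (pos j + ?n j + ?n j)" if "j < ?m" for j
    unfolding pos_def using length_encode_forest_take_Suc[OF that, of code] by simp
  have posN: "pos j \<le> 3 * N + 1" for j
    unfolding pos_def length_encode_forest using SN[of j] mN by (simp add: S_def)
  have posm: "(pos j + ?n j) mod 2 ^ w = pos j + ?n j"
    "(pos j + ?n j + ?n j) mod 2 ^ w = pos j + ?n j + ?n j"
    "Suc (pos j + ?n j + ?n j) mod 2 ^ w = pos (Suc j)" if "j < ?m" for j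
    using posS[OF that] posN[of "Suc j"] w by (simp_all add: mod_less)
  have at: "tree_at code w inp (pos j) (Ts ! j)" if j: "j < ?m" for j
  proof -
    obtain pre post where p: "inp = pre @ encode_tree code (Ts ! j) @ post" "length pre = pos j"
      using encode_forest_split[OF j, of code] unfolding inp_def pos_def by blast
    have "length pre + 2 * ?n j < 2 ^ w" using posS[OF j] posN[of "Suc j"] w p(2) by simp
    then have "tree_at code w (pre @ encode_tree code (Ts ! j) @ post) (length pre) (Ts ! j)"
      using trees j code by (intro tree_at_encode) auto
    then show ?thesis using p by simp
  qed
  have size: "read_input inp (pos j) mod 2 ^ w = ?n j" if "j < ?m" for j
    using at[OF that] unfolding tree_at_def by (auto intro: mod_less)
  have sizem: "read_input inp 0 mod 2 ^ w = ?m"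
    using mN w by (simp add: inp_def encode_forest_def read_input_def)
  have lt: "Suc 0 < 2 ^ w" "2 < (2 :: nat) ^ w" using w by linarith+
  note md = lt[THEN mod_less]
  define Q where "Q = (\<lambda>(_ :: nat) (D :: store). wreg D rZero = 0 \<and> wreg D rOne = 1 \<and>
     wreg D rBase * wreg D rBase \<le> 2 ^ w \<and>
     (\<exists>st. trie (wreg D rBase) (wreg D rCount) st (wmem D) (rmem D)
        (forest_weight code lam Ts \<alpha>s ?m)))"

  let ?body2 = "Block [WOp WAdd rTree rTree rOne, WInput rSize rPos] ;;
        insert_tree ;;
        Block [WOp WAdd rPos rPos rSize, WOp WAdd rPos rPos rSize, WOp WAdd rPos rPos rOne]"
  \<comment> \<open>A tree with \<open>n\<close> nodes uses up to \<open>2 * n * n\<close> numbers;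
    weakening this to \<open>2 * N * n\<close> makes the budget additive over the trees, ending at
    \<open>1 + 2 * N * N\<close>. The 1 is the root state.\<close>
  define J where "J = (\<lambda>j (_ :: nat) (s :: store). wreg s rZero = 0 \<and> wreg s rOne = 1 \<and>
     wreg s rBase = B * B \<and> wreg s rTrees = ?m \<and> wreg s rTree = j \<and> wreg s rPos = pos j \<and>
     rreg s fLam = lam \<and> wreg s rCount \<le> 1 + 2 * N * S j \<and>
     (\<exists>st. trie (B * B) (wreg s rCount) st (wmem s) (rmem s) (forest_weight code lam Ts \<alpha>s j)))"
  have loop2: "wp w inp (lam # \<alpha>s) (WhileNe rTree rTrees ?body2) Q k s" if "J 0 k s" for k s
  proof (rule wp_for[where I = J and n = ?m, OF _ _ that])
    fix k s assume "J ?m k s"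
    then show "wreg s rTree = wreg s rTrees \<and> Q (Suc k) s"
      unfolding J_def Q_def using BK by auto
  next
    fix j k s assume j: "j < ?m" and J: "J j k s"
    from J obtain st where
      t: "trie (B * B) (wreg s rCount) st (wmem s) (rmem s) (forest_weight code lam Ts \<alpha>s j)"
      unfolding J_def by blast
    have r: "wreg s rZero = 0" "wreg s rOne = 1" "wreg s rBase = B * B" "wreg s rTrees = ?m"
      "wreg s rTree = j" "wreg s rPos = pos j" "rreg s fLam = lam"
      and c: "wreg s rCount \<le> 1 + 2 * N * S j"
      using J unfolding J_def by simp_all
    have SjN: "S j + ?n j \<le> N" using SS[OF j] SN[of "Suc j"] by simp
    have nn: "2 * ?n j * ?n j \<le> 2 * N * ?n j" using SjN by (intro mult_right_mono) auto
    have "2 * N * (S j + ?n j) \<le> 2 * N * N" using SjN by (intro mult_left_mono) auto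
    moreover have "1 + 2 * N * N < B * B" unfolding B_def by (simp add: algebra_simps)
    ultimately have cK: "wreg s rCount + 2 * ?n j * ?n j < B * B"
      using c nn by (simp only: distrib_left)
    let ?s1 = "s\<lparr>wreg := (wreg s)(rTree := Suc j, rSize := ?n j)\<rparr>"
    let ?B = "Block [WOp WAdd rPos rPos rSize, WOp WAdd rPos rPos rSize, WOp WAdd rPos rPos rOne]"
    have "wp w inp (lam # \<alpha>s) insert_tree
        (wp w inp (lam # \<alpha>s) ?B (\<lambda>k'. J (Suc j) (Suc k'))) (Suc (Suc (Suc k))) ?s1"
    proof (rule wp_insert_tree[OF _ at[OF j], where K = "B * B" and st = st
          and W = "forest_weight code lam Ts \<alpha>s j" and lam = lam and \<alpha> = "\<alpha>s ! j"])
      fix k' st' and s' :: store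
      assume s': "rreg s' fLam = lam"
        "\<forall>r \<in> {rZero, rOne, rBase, rTrees, rTree, rPos, rSize}. wreg s' r = wreg ?s1 r"
        "wreg s' rCount \<le> wreg ?s1 rCount + 2 * ?n j * ?n j"
        and t': "trie (B * B) (wreg s' rCount) st' (wmem s') (rmem s')
          (\<lambda>x. forest_weight code lam Ts \<alpha>s j x +
             (\<Sum>i<?n j. node_weight code lam (\<alpha>s ! j) (Ts ! j) i x))"
      have fw: "(\<lambda>x. forest_weight code lam Ts \<alpha>s j x +
             (\<Sum>i<?n j. node_weight code lam (\<alpha>s ! j) (Ts ! j) i x)) =
          forest_weight code lam Ts \<alpha>s (Suc j)"
        by (simp add: fun_eq_iff forest_weight_def)
      have "wreg s' rCount \<le> wreg s rCount + 2 * ?n j * ?n j" using s'(3) by simp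
      moreover have "2 * N * S (Suc j) = 2 * N * S j + 2 * N * ?n j"
        unfolding SS[OF j] by (rule distrib_left)
      ultimately have c': "wreg s' rCount \<le> 1 + 2 * N * S (Suc j)"
        using c nn by linarith
      show "wp w inp (lam # \<alpha>s) ?B (\<lambda>k'. J (Suc j) (Suc k')) k' s'"
        using s'(1,2) t' c' r posm[OF j] unfolding fw by (auto simp: J_def)
    qed (use trees j t r cK BK len in \<open>auto simp: read_input_def\<close>)
    moreover have "Suc j mod 2 ^ w = Suc j" using j mN w by simp
    ultimately show "wreg s rTree \<noteq> wreg s rTrees \<and>
        wp w inp (lam # \<alpha>s) ?body2 (\<lambda>k'. J (Suc j) (Suc k')) (Suc k) s"
      using j r size[OF j] by simp
  qed

  let ?mid = "Block [WOp WMul rBase rBase rBase, WOp WAdd rPos rOne rZero,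
     WOp WAdd rTree rZero rZero, WOp WAdd rCount rOne rZero, RInput fLam rZero]"
  let ?body1 = "Block [WOp WAdd rTree rTree rOne, WInput rSize rPos, WOp WAdd rBase rBase rSize,
               WOp WAdd rBase rBase rSize, WOp WAdd rPos rPos rSize, WOp WAdd rPos rPos rSize,
               WOp WAdd rPos rPos rOne]"
  \<comment> \<open>The last two clauses record that the first pass writes no memory: all-zero
    memory already is the trie whose only string is empty.\<close>
  define I where "I = (\<lambda>j (_ :: nat) (s :: store). wreg s rZero = 0 \<and> wreg s rOne = 1 \<and>
     wreg s rBase = 2 + 2 * S j \<and> wreg s rTrees = ?m \<and> wreg s rTree = j \<and> wreg s rPos = pos j \<and>
     wmem s = (\<lambda>_. 0) \<and> rmem s = (\<lambda>_. 0))"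
  have mid: "wp w inp (lam # \<alpha>s) ?mid (wp w inp (lam # \<alpha>s) (WhileNe rTree rTrees ?body2) Q) k s"
    if "I ?m k' s" for k k' s
  proof -
    have "1 < B * B" unfolding B_def by simp
    from trie_init[OF this] have "\<exists>st. trie (B * B) 1 st (\<lambda>_. 0) (\<lambda>_. 0) (\<lambda>_. 0)" by blast
    moreover have "forest_weight code lam Ts \<alpha>s 0 = (\<lambda>_. 0)"
      by (simp add: fun_eq_iff forest_weight_def)
    ultimately show ?thesis
      using that Sm Bm md pos0
      by (simp, intro loop2) (simp add: I_def J_def B_def read_input_def)
  qed
  have loop1: "wp w inp (lam # \<alpha>s) (WhileNe rTree rTrees ?body1)
      (wp w inp (lam # \<alpha>s) (?mid ;; WhileNe rTree rTrees ?body2) Q) k s" if "I 0 k s" for k s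
  proof (rule wp_for[where I = I and n = ?m, OF _ _ that])
    fix k s assume I: "I ?m k s"
    then show "wreg s rTree = wreg s rTrees \<and>
        wp w inp (lam # \<alpha>s) (?mid ;; WhileNe rTree rTrees ?body2) Q (Suc k) s"
      unfolding wp_Seq using mid[OF I, of "Suc k"] by (auto simp: I_def)
  next
    fix j k s assume j: "j < ?m" and I: "I j k s"
    have "2 + 2 * S (Suc j) < 2 ^ w" using SN[of "Suc j"] w by linarith
    then have b: "(2 + 2 * S j + ?n j) mod 2 ^ w = 2 + 2 * S j + ?n j"
      "(2 + 2 * S j + ?n j + ?n j) mod 2 ^ w = 2 + 2 * S (Suc j)"
      using SS[OF j] by (simp_all add: mod_less)
    have "Suc j mod 2 ^ w = Suc j" using j mN w by simp
    then show "wreg s rTree \<noteq> wreg s rTrees \<and>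
        wp w inp (lam # \<alpha>s) ?body1 (\<lambda>k'. I (Suc j) (Suc k')) (Suc k) s"
      using I j size[OF j] posm[OF j] b by (simp add: I_def)
  qed
  have "wp w inp (lam # \<alpha>s) preprocess_com Q 0 empty_store"
    unfolding preprocess_com_def using sizem md S0 pos0
    by (simp add: empty_store_def, intro loop1) (simp add: I_def)
  then show ?thesis unfolding Q_def inp_def .
qed

section \<open>Querying\<close>

text \<open>The body is free of branches: rank 0 or state 0 leads to state 0, where the weight read
  is 0. As the tree starts at input position 0, \<open>rCur\<close> itself is the position of the
  label.\<close>

definition query_walk :: com where
  "query_walk =
     WhileNe rCur rZero
       (Block [WInput rLabel rCur, WLoad rVal rLabel, WOp WMod rRank rVal rBase,
               WOp WMul rCell rState rBase, WOp WAdd rCell rCell rRank, WLoad rVal rCell,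
               WOp WDiv rState rVal rBase, RLoad fVal rState, ROp RAdd fAcc fAcc fVal,
               WOp WAdd rAddr rCur rSize, WInput rCur rAddr])"

definition query_com :: com where
  "query_com =
     Block [WInput rSize rZero, WOp WAdd rNode rZero rZero, ROfWord fAcc rZero] ;;
     WhileNe rNode rSize
       (Block [WOp WAdd rNode rNode rOne, WOp WAdd rCur rNode rZero,
               WOp WAdd rState rOne rZero] ;;
        query_walk)"

text \<open>The strings met by a walk along \<open>u\<close> after \<open>p\<close> has been read;
  for \<open>p = []\<close>, the nonempty prefixes of \<open>u\<close>. Each is met once, so the
  total of a walk is a sum over a set.\<close>

definition extensions :: "'a list \<Rightarrow> 'a list \<Rightarrow> 'a list set" where
  "extensions p u = {s. strict_prefix p s \<and> prefix s (p @ u)}"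

lemma extensions_Nil [simp]: "extensions p [] = {}"
  unfolding extensions_def by auto

lemma extensions_Cons: "extensions p (a # u) = insert (p @ [a]) (extensions (p @ [a]) u)"
  unfolding extensions_def
  by (auto simp: strict_prefix_def prefix_def append_eq_append_conv2
      append_eq_Cons_conv Cons_eq_append_conv)

lemma finite_extensions [simp]: "finite (extensions p u)"
  by (induction u arbitrary: p) (simp_all add: extensions_Cons)

lemma sum_extensions_Cons:
  "sum f (extensions p (a # u)) = f (p @ [a]) + sum f (extensions (p @ [a]) u)"
proof -
  have "p @ [a] \<notin> extensions (p @ [a]) u" by (simp add: extensions_def)
  then show ?thesis unfolding extensions_Cons by simp
qed

text \<open>Per node, 11 instructions, a test and a jump back make 13; the final 1 is the test that
  leaves the loop. The trie is fixed throughout the induction because a query writes no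
  memory.\<close>

lemma wp_query_walk:
  assumes "up_string T i u" "i < length T"
    and T: "tree_at code w inp 0 T"
    and K2: "K * K \<le> 2 ^ w"
    and t: "trie K cnt st mem rm W"
  shows "wmem s = mem \<Longrightarrow> rmem s = rm \<Longrightarrow>
     wreg s rZero = 0 \<Longrightarrow> wreg s rOne = 1 \<Longrightarrow> wreg s rBase = K \<Longrightarrow>
     wreg s rSize = length T \<Longrightarrow> wreg s rCur = Suc i \<Longrightarrow> wreg s rState = st p \<Longrightarrow>
     (\<And>s'. wmem s' = mem \<Longrightarrow> rmem s' = rm \<Longrightarrow>
        \<forall>r \<in> {rZero, rOne, rBase, rSize, rNode}. wreg s' r = wreg s r \<Longrightarrow>
        rreg s' fAcc = rreg s fAcc + sum W (extensions p (map code u)) \<Longrightarrow>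
        Q (k + 13 * length u + 1) s') \<Longrightarrow>
     wp w inp rinp query_walk Q k s"
  using assms(1,2)
proof (induction arbitrary: p s k rule: up_string.induct)
  let ?B = "Block [WInput rLabel rCur, WLoad rVal rLabel, WOp WMod rRank rVal rBase,
               WOp WMul rCell rState rBase, WOp WAdd rCell rCell rRank, WLoad rVal rCell,
               WOp WDiv rState rVal rBase, RLoad fVal rState, ROp RAdd fAcc fAcc fVal,
               WOp WAdd rAddr rCur rSize, WInput rCur rAddr]"
  have body: "wp w inp rinp ?B R k s"
    if i: "i < length T" and s: "wmem s = mem" "rmem s = rm" "wreg s rZero = 0" "wreg s rBase = K"
      "wreg s rSize = length T" "wreg s rCur = Suc i" "wreg s rState = st p"
    and R: "\<And>s'. wmem s' = mem \<Longrightarrow> rmem s' = rm \<Longrightarrow>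
      \<forall>r \<in> {rZero, rOne, rBase, rSize, rNode}. wreg s' r = wreg s r \<Longrightarrow>
      wreg s' rCur = parent_word T i \<Longrightarrow> wreg s' rState = st (p @ [code (label T i)]) \<Longrightarrow>
      rreg s' fAcc = rreg s fAcc + W (p @ [code (label T i)]) \<Longrightarrow> R (k + 11) s'"
    for i s p k R
  proof -
    let ?a = "code (label T i)"
    let ?c = "st p * K + mem ?a mod K"
    have K: "0 < K" using trieD(2)[OF t] by simp
    then have Kw: "K \<le> 2 ^ w" using K2 by (meson le_trans mult_le_mono1 Suc_leI nat_mult_1
        le_square)
    have small: "x mod 2 ^ w = x" if "x < K" for x
      by (rule mod_less, rule less_le_trans[OF that Kw])
    have st: "st p < K" for p using trieD(2)[OF t] trieD(4)[OF t, of p] by simp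
    have "?c < 2 ^ w" by (rule less_le_trans[OF table_position_less K2]) (use K st in auto)
    then have c: "st p * K mod 2 ^ w = st p * K" "?c mod 2 ^ w = ?c" by (simp_all add: mod_less)
    have rank: "mem ?a mod K mod 2 ^ w = mem ?a mod K" by (rule small) (use K in simp)
    have d: "mem ?c div K = st (p @ [?a])" by (rule trieD(8)[OF t])
    have addr: "(Suc i + length T) mod 2 ^ w = Suc i + length T"
      and inp: "read_input inp (Suc i) mod 2 ^ w = ?a"
        "read_input inp (Suc i + length T) mod 2 ^ w = parent_word T i"
      using T i unfolding tree_at_def by (auto simp: mod_less)
    have "k + 11 = Suc (Suc (Suc (Suc (Suc (Suc (Suc (Suc (Suc (Suc (Suc k))))))))))" by simp
    note R = R[unfolded this]
    show ?thesis
      using s c rank d addr inp small[OF st] trieD(12)[OF t]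
      by (simp, intro R) simp_all
  qed
  note loop = wp_WhileNe[of w inp rinp rCur rZero _ Q]
  {
    case (root i)
    have pw: "parent_word T i = 0" using root.hyps by (simp add: parent_word_def)
    have "wp w inp rinp ?B (\<lambda>k'. wp w inp rinp query_walk Q (Suc k')) (Suc k) s"
    proof (rule body[OF root.prems(10,1,2,3,5-8)])
      fix s' :: store assume s': "wmem s' = mem" "rmem s' = rm"
        "\<forall>r \<in> {rZero, rOne, rBase, rSize, rNode}. wreg s' r = wreg s r"
        "wreg s' rCur = parent_word T i"
        "rreg s' fAcc = rreg s fAcc + W (p @ [code (label T i)])"
      then show "wp w inp rinp query_walk Q (Suc (Suc k + 11)) s'"
        using pw root.prems(3) root.prems(9)[of s']
        by (simp add: query_walk_def loop sum_extensions_Cons)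
    qed
    then show ?case
      using root.prems(3,7) unfolding query_walk_def by (subst loop) simp
  next
    case (step i q u)
    have pw: "parent_word T i = Suc q" using step.hyps by (simp add: parent_word_def)
    then have q: "q < length T" using T step.prems(10) unfolding tree_at_def by auto
    have "wp w inp rinp ?B (\<lambda>k'. wp w inp rinp query_walk Q (Suc k')) (Suc k) s"
    proof (rule body[OF step.prems(10,1,2,3,5-8)])
      fix s' :: store assume s': "wmem s' = mem" "rmem s' = rm"
        "\<forall>r \<in> {rZero, rOne, rBase, rSize, rNode}. wreg s' r = wreg s r"
        "wreg s' rCur = parent_word T i" "wreg s' rState = st (p @ [code (label T i)])"
        "rreg s' fAcc = rreg s fAcc + W (p @ [code (label T i)])"
      show "wp w inp rinp query_walk Q (Suc (Suc k + 11)) s'"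
      proof (rule step.IH[of s' "p @ [code (label T i)]"])
        fix s2 :: store assume s2: "wmem s2 = mem" "rmem s2 = rm"
          "\<forall>r \<in> {rZero, rOne, rBase, rSize, rNode}. wreg s2 r = wreg s' r"
          "rreg s2 fAcc = rreg s' fAcc +
             sum W (extensions (p @ [code (label T i)]) (map code u))"
        have "Q (k + 13 * length (label T i # u) + 1) s2"
          by (rule step.prems(9)) (use s' s2 in \<open>simp_all add: sum_extensions_Cons\<close>)
        then show "Q (Suc (Suc k + 11) + 13 * length u + 1) s2" by simp
      qed (use s' pw q step.prems in simp_all)
    qed
    then show ?case
      using step.prems(3,7) unfolding query_walk_def by (subst loop) simp
  }
qed

lemma wp_query:
  assumes T: "rooted_tree \<Sigma> T" "tree_at code w inp 0 T"
    and t: "trie (wreg D rBase) cnt st (wmem D) (rmem D) W"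
    and regs: "wreg D rZero = 0" "wreg D rOne = 1" "wreg D rBase * wreg D rBase \<le> 2 ^ w"
  shows "wp w inp rinp query_com
     (\<lambda>k s. k \<le> 23 * length T ^ 2 \<and>
        rreg s fAcc = (\<Sum>i<length T. sum W (extensions [] (map code (node_suffix T i))))) 0 D"
    (is "wp w inp rinp query_com ?Q 0 D")
proof -
  let ?n = "length T"
  let ?f = "\<lambda>i. sum W (extensions [] (map code (node_suffix T i)))"
  \<comment> \<open>3 instructions set up the loop. Per node, 3 instructions, the test, the jump
    back and the last test of the inner loop make 6, besides 13 for each step of the walk.\<close>
  define I where "I = (\<lambda>i (k :: nat) (s :: store). wmem s = wmem D \<and> rmem s = rmem D \<and>
     (\<forall>r \<in> {rZero, rOne, rBase}. wreg s r = wreg D r) \<and> wreg s rSize = ?n \<and> wreg s rNode = i \<and>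
     rreg s fAcc = (\<Sum>j<i. ?f j) \<and> k \<le> 3 + i * (6 + 13 * ?n))"
  let ?body = "Block [WOp WAdd rNode rNode rOne, WOp WAdd rCur rNode rZero,
               WOp WAdd rState rOne rZero] ;; query_walk"
  have n: "2 * ?n < 2 ^ w" and n0: "read_input inp 0 = ?n"
    using T(2) unfolding tree_at_def by auto
  have pos: "0 < ?n" using T(1) unfolding rooted_tree_def by auto
  have "wp w inp rinp (WhileNe rNode rSize ?body) ?Q 3
      (D\<lparr>wreg := (wreg D)(rSize := ?n, rNode := 0), rreg := (rreg D)(fAcc := 0)\<rparr>)"
  proof (rule wp_for[where I = I and n = ?n])
    show "I 0 3 (D\<lparr>wreg := (wreg D)(rSize := ?n, rNode := 0), rreg := (rreg D)(fAcc := 0)\<rparr>)"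
      unfolding I_def by simp
  next
    fix k s assume I: "I ?n k s"
    then have "Suc k \<le> 4 + ?n * (6 + 13 * ?n)" unfolding I_def by simp
    \<comment> \<open>The test that ends the outer loop has raised 3 to 4, and
      \<open>4 + 6 + 13 = 23\<close> suffices because \<open>?n\<close> is positive.\<close>
    also have "\<dots> \<le> 23 * ?n\<^sup>2"
    proof -
      have "?n \<le> ?n * ?n" "1 \<le> ?n * ?n" using pos by (simp_all add: Suc_le_eq)
      moreover have "4 + ?n * (6 + 13 * ?n) = 4 + 6 * ?n + 13 * (?n * ?n)"
        by (simp add: algebra_simps)
      ultimately show ?thesis unfolding power2_eq_square by linarith
    qed
    finally show "wreg s rNode = wreg s rSize \<and> ?Q (Suc k) s" using I unfolding I_def by simp
  next
    fix i k s assume i: "i < ?n" and I: "I i k s"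
    have lt: "Suc i < 2 ^ w" "Suc 0 < 2 ^ w" using i n by linarith+
    note md = lt[THEN mod_less]
    have u: "length (node_suffix T i) \<le> ?n" by (rule length_node_suffix[OF T(1) i])
    let ?s1 = "s\<lparr>wreg := (wreg s)(rNode := Suc i, rCur := Suc i, rState := 1)\<rparr>"
    have "wp w inp rinp query_walk (\<lambda>k'. I (Suc i) (Suc k')) (Suc (Suc (Suc (Suc k)))) ?s1"
    proof (rule wp_query_walk[OF up_string_node_suffix[OF T(1) i] i T(2) regs(3) t,
          where p = "[]"])
      fix s' :: store assume "wmem s' = wmem D" "rmem s' = rmem D"
        "\<forall>r \<in> {rZero, rOne, rBase, rSize, rNode}. wreg s' r = wreg ?s1 r"
        "rreg s' fAcc = rreg ?s1 fAcc + ?f i"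
      then show "I (Suc i)
          (Suc (Suc (Suc (Suc (Suc k))) + 13 * length (node_suffix T i) + 1)) s'"
        using I u unfolding I_def by simp
    qed (use I regs trieD(3)[OF t] in \<open>simp_all add: I_def\<close>)
    then show "wreg s rNode \<noteq> wreg s rSize \<and>
        wp w inp rinp ?body (\<lambda>k'. I (Suc i) (Suc k')) (Suc k) s"
      using I i regs md by (simp add: I_def)
  qed
  moreover have "?n mod 2 ^ w = ?n" using n by simp
  ultimately show ?thesis
    unfolding query_com_def using regs n0 by (simp add: numeral_3_eq_3)
qed

section \<open>The prediction as a sum over query suffixes\<close>

text \<open>Strings outside \<open>subpaths T\<close> contribute nothing. For the others
  \<open>num T s\<close> is a sum of indicators over the nodes of \<open>T\<close>, and exchanging
  the sums gathers at each node the prefixes of its suffix.\<close>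

lemma subpath_kernel_eq:
  "subpath_kernel lam T' T =
     (\<Sum>i<length T. \<Sum>s \<in> extensions [] (node_suffix T i). lam ^ length s * real (num T' s))"
proof -
  have ext: "extensions [] u = {s. s \<noteq> [] \<and> prefix s u}" for u :: "'a list"
    unfolding extensions_def by (auto simp: strict_prefix_def)
  have sub: "subpaths T = (\<Union>i<length T. extensions [] (node_suffix T i))" for T :: "'a ltree"
    unfolding ext subpaths_def by auto
  then have fin: "finite (subpaths T)" for T :: "'a ltree" by simp
  have num: "real (num T s) = (\<Sum>i<length T. if prefix s (node_suffix T i) then 1 else 0)" for s
  proof -
    have "{i. i < length T \<and> prefix s (node_suffix T i)} =
        {..<length T} \<inter> {i. prefix s (node_suffix T i)}" by auto
    then show ?thesis unfolding num_def by (simp add: sum.If_cases)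
  qed
  have "num T s = 0" if "s \<in> subpaths T' - subpaths T" for s
    using that unfolding subpaths_def num_def by auto
  then have "subpath_kernel lam T' T =
      (\<Sum>s \<in> subpaths T. lam ^ length s * real (num T' s) * real (num T s))"
    unfolding subpath_kernel_def by (intro sum.mono_neutral_right) (auto simp: fin)
  also have "\<dots> = (\<Sum>s \<in> subpaths T. \<Sum>i<length T.
      if prefix s (node_suffix T i) then lam ^ length s * real (num T' s) else 0)"
    unfolding num by (simp add: sum_distrib_left if_distrib cong: if_cong)
  also have "\<dots> = (\<Sum>i<length T. \<Sum>s \<in> subpaths T.
      if prefix s (node_suffix T i) then lam ^ length s * real (num T' s) else 0)"
    by (rule sum.swap)
  also have "\<dots> = (\<Sum>i<length T. \<Sum>s \<in> extensions [] (node_suffix T i).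
      lam ^ length s * real (num T' s))"
  proof (rule sum.cong[OF refl])
    fix i assume "i \<in> {..<length T}"
    then have "{s \<in> subpaths T. prefix s (node_suffix T i)} = extensions [] (node_suffix T i)"
      unfolding ext subpaths_def by auto
    then show "(\<Sum>s \<in> subpaths T. if prefix s (node_suffix T i)
          then lam ^ length s * real (num T' s) else 0) =
        (\<Sum>s \<in> extensions [] (node_suffix T i). lam ^ length s * real (num T' s))"
      using fin by (simp add: sum.If_cases Int_def)
  qed
  finally show ?thesis .
qed

text \<open>Codes are injective on \<open>\<Sigma>\<close> only, so encoded strings are compared
  faithfully just over that alphabet; node suffixes stay inside it by
  \<open>set_node_suffix\<close>.\<close>

lemma prefix_map_inj_on:
  assumes "inj_on f A" "set xs \<subseteq> A" "set ys \<subseteq> A"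
  shows "prefix (map f xs) (map f ys) \<longleftrightarrow> prefix xs ys"
proof
  assume "prefix (map f xs) (map f ys)"
  then have "map f xs = map f (take (length xs) ys)"
    by (metis length_map prefix_def append_eq_conv_conj take_map)
  then have "xs = take (length xs) ys"
    by (rule map_inj_on) (use assms in \<open>auto intro: inj_on_subset dest: in_set_takeD\<close>)
  then show "prefix xs ys" by (metis take_is_prefix)
qed (rule map_mono_prefix)

lemma extensions_map:
  "extensions [] (map f u) = map f ` extensions [] u"
proof -
  have "extensions (map f p) (map f u) = map f ` extensions p u" for p
  proof (induction u arbitrary: p)
    case (Cons a u)
    then show ?case using Cons.IH[of "p @ [a]"] by (simp add: extensions_Cons)
  qed simp
  from this[of "[]"] show ?thesis by simp
qed

text \<open>Links the sum over encoded strings that a query accumulates to the kernel: encoding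
  changes no prefix count and merges no two prefixes of a suffix.\<close>

lemma prediction_eq:
  assumes trees: "\<forall>T \<in> set Ts. rooted_tree \<Sigma> T" and T: "rooted_tree \<Sigma> T"
    and inj: "inj_on code \<Sigma>"
  shows "prediction lam Ts \<alpha>s T = (\<Sum>i<length T.
     sum (forest_weight code lam Ts \<alpha>s (length Ts)) (extensions [] (map code (node_suffix T i))))"
proof -
  have weight: "forest_weight code lam Ts \<alpha>s (length Ts) (map code s) =
      (\<Sum>j<length Ts. \<alpha>s ! j * (lam ^ length s * real (num (Ts ! j) s)))"
    if s: "s \<noteq> []" "set s \<subseteq> \<Sigma>" for s
    unfolding forest_weight_def
  proof (rule sum.cong[OF refl])
    fix j assume "j \<in> {..<length Ts}"
    then have Tj: "rooted_tree \<Sigma> (Ts ! j)" using trees by simp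
    have "(\<Sum>i<length (Ts ! j). node_weight code lam (\<alpha>s ! j) (Ts ! j) i (map code s)) =
        (\<Sum>i<length (Ts ! j). if prefix s (node_suffix (Ts ! j) i)
           then \<alpha>s ! j * lam ^ length s else 0)"
      using s set_node_suffix[OF Tj] prefix_map_inj_on[OF inj s(2)]
      by (intro sum.cong) (simp_all add: node_weight_def)
    also have "\<dots> = \<alpha>s ! j * (lam ^ length s * real (num (Ts ! j) s))"
    proof -
      have "{..<length (Ts ! j)} \<inter> {i. prefix s (node_suffix (Ts ! j) i)} =
          {i. i < length (Ts ! j) \<and> prefix s (node_suffix (Ts ! j) i)}" by auto
      then show ?thesis by (simp add: sum.If_cases num_def)
    qed
    finally show "(\<Sum>i<length (Ts ! j). node_weight code lam (\<alpha>s ! j) (Ts ! j) i (map code s)) =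
        \<alpha>s ! j * (lam ^ length s * real (num (Ts ! j) s))" .
  qed
  have "prediction lam Ts \<alpha>s T = (\<Sum>j<length Ts. \<Sum>i<length T.
      \<Sum>s \<in> extensions [] (node_suffix T i). \<alpha>s ! j * (lam ^ length s * real (num (Ts ! j) s)))"
    unfolding prediction_def subpath_kernel_eq by (simp add: sum_distrib_left)
  also have "\<dots> = (\<Sum>i<length T. \<Sum>j<length Ts.
      \<Sum>s \<in> extensions [] (node_suffix T i). \<alpha>s ! j * (lam ^ length s * real (num (Ts ! j) s)))"
    by (rule sum.swap)
  also have "\<dots> = (\<Sum>i<length T.
     sum (forest_weight code lam Ts \<alpha>s (length Ts)) (extensions [] (map code (node_suffix T i))))"
  proof (rule sum.cong[OF refl])
    fix i assume i: "i \<in> {..<length T}"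
    let ?E = "extensions [] (node_suffix T i)"
    have E: "s \<noteq> [] \<and> set s \<subseteq> \<Sigma>" if "s \<in> ?E" for s
      using that i set_node_suffix[OF T, of i] set_mono_prefix[of s "node_suffix T i"]
      unfolding extensions_def by auto
    have "inj_on (map code) ?E"
      by (rule inj_onI, rule map_inj_on) (use E inj in \<open>auto intro: inj_on_subset\<close>)
    then have "sum (forest_weight code lam Ts \<alpha>s (length Ts)) (map code ` ?E) =
        (\<Sum>s \<in> ?E. forest_weight code lam Ts \<alpha>s (length Ts) (map code s))"
      by (simp add: sum.reindex)
    also have "\<dots> = (\<Sum>s \<in> ?E. \<Sum>j<length Ts. \<alpha>s ! j * (lam ^ length s * real (num (Ts ! j) s)))"
      by (rule sum.cong[OF refl], rule weight) (use E in auto)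
    also have "\<dots> = (\<Sum>j<length Ts. \<Sum>s \<in> ?E.
        \<alpha>s ! j * (lam ^ length s * real (num (Ts ! j) s)))"
      by (rule sum.swap)
    finally show "(\<Sum>j<length Ts. \<Sum>s \<in> ?E. \<alpha>s ! j * (lam ^ length s * real (num (Ts ! j) s))) =
        sum (forest_weight code lam Ts \<alpha>s (length Ts)) (extensions [] (map code (node_suffix T i)))"
      unfolding extensions_map by simp
  qed
  finally show ?thesis .
qed

theorem theorem3:
  fixes lam :: real
  assumes "0 < lam" and "lam \<le> 1"
  shows "\<exists>(preprocess :: instr list) (query :: instr list) (c :: nat) (C :: nat).
    \<forall>(\<Sigma> :: 'a::linorder set) (code :: 'a \<Rightarrow> nat) (w :: nat) (Ts :: 'a ltree list) (\<alpha>s :: real list).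
      inj_on code \<Sigma> \<and> (\<forall>a \<in> \<Sigma>. code a < 2 ^ w) \<and>
      (\<forall>T \<in> set Ts. rooted_tree \<Sigma> T) \<and> length \<alpha>s = length Ts \<and> addressable c w Ts \<longrightarrow>
      (\<exists>D. (\<exists>t. halts_within w preprocess (encode_forest code Ts) (lam # \<alpha>s) empty_store t D) \<and>
           (\<forall>T. rooted_tree \<Sigma> T \<and> addressable c w (T # Ts) \<longrightarrow>
              (\<exists>S. halts_within w query (encode_tree code T) [] D (C * length T ^ 2) S \<and>
                   rreg S 0 = prediction lam Ts \<alpha>s T)))"
\<comment> \<open>Programs and constants are fixed before alphabet, coding, word length and support
  vectors. 8 stems from \<open>trie_base_bound\<close>, 23 from \<open>wp_query\<close>.\<close>
proof (rule exI[of _ "compile 0 preprocess_com"], rule exI[of _ "compile 0 query_com"],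
    rule exI[of _ 8], rule exI[of _ 23], intro allI impI, elim conjE)
  fix \<Sigma> :: "'a set" and code :: "'a \<Rightarrow> nat" and w :: nat and Ts :: "'a ltree list"
    and \<alpha>s :: "real list"
  assume inj: "inj_on code \<Sigma>" and code: "\<forall>a \<in> \<Sigma>. code a < 2 ^ w"
    and trees: "\<forall>T \<in> set Ts. rooted_tree \<Sigma> T" and len: "length \<alpha>s = length Ts"
    and addr: "addressable 8 w Ts"
  let ?W = "forest_weight code lam Ts \<alpha>s (length Ts)"
  obtain t D st where
    D: "exec w (encode_forest code Ts) (lam # \<alpha>s) preprocess_com empty_store t D"
      "wreg D rZero = 0" "wreg D rOne = 1" "wreg D rBase * wreg D rBase \<le> 2 ^ w"
    and trie: "trie (wreg D rBase) (wreg D rCount) st (wmem D) (rmem D) ?W"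
    using wp_preprocess[OF trees code len addr, of lam] unfolding wp_def by blast
  have "\<exists>S. halts_within w (compile 0 query_com) (encode_tree code T) [] D (23 * length T ^ 2) S \<and>
      rreg S 0 = prediction lam Ts \<alpha>s T"
    if T: "rooted_tree \<Sigma> T" and addrT: "addressable 8 w (T # Ts)" for T
  proof -
    have "3 * (length T + sum_list (map length Ts)) + 3 < 2 ^ w"
      using trie_base_bound(2)[of "length T + sum_list (map length Ts)" w] addrT
      unfolding addressable_def by simp
    then have "tree_at code w ([] @ encode_tree code T @ []) (length ([] :: nat list)) T"
      by (intro tree_at_encode[OF T code]) simp
    then have at: "tree_at code w (encode_tree code T) 0 T" by simp
    obtain k S where "exec w (encode_tree code T) [] query_com D k S" "k \<le> 23 * length T ^ 2"
      "rreg S fAcc = (\<Sum>i<length T. sum ?W (extensions [] (map code (node_suffix T i))))"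
      using wp_query[OF T at trie D(2-4), of "[]"] unfolding wp_def by auto
    then show ?thesis
      using exec_halts_within prediction_eq[OF trees T inj] by metis
  qed
  then show "\<exists>D. (\<exists>t. halts_within w (compile 0 preprocess_com) (encode_forest code Ts) (lam # \<alpha>s)
         empty_store t D) \<and>
      (\<forall>T. rooted_tree \<Sigma> T \<and> addressable 8 w (T # Ts) \<longrightarrow>
         (\<exists>S. halts_within w (compile 0 query_com) (encode_tree code T) [] D
            (23 * length T ^ 2) S \<and> rreg S 0 = prediction lam Ts \<alpha>s T))"
    using exec_halts_within[OF D(1) order_refl] by blast
qed

end
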